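(* Let $1\le p<\infty$ and let $d_{w,p}$ be a Lorentz sequence space. The set $\mathcal{SS}_{d_{w,p}}$ of all $d_{w,p}$-strictly singular operators in $L(d_{w,p})$ is the greatest proper ideal in $L(d_{w,p})$: it is a proper two-sided ideal and contains every proper ideal of $L(d_{w,p})$. In particular, $\mathcal{SS}_{d_{w,p}}$ is norm closed.
   Context: Let $1\le p<\infty$ and let $w=(w_n)$ be a real sequence with $w_1=1$, $w_n\downarrow 0$ and $\sum_n w_n=\infty$. The Lorentz sequence space $d_{w,p}$ is the Banach space of all $x=(x_n)\in c_0$ with $\|x\|_{d_{w,p}}=\big(\sum_{n}w_n (x^*_n)^p\big)^{1/p}<\infty$, where $(x^*_n)$ is the non-increasing rearrangement of $(|x_n|)$. An operator $T\in L(d_{w,p})$ is $d_{w,p}$-strictly singular if for every closed subspace $Z\subseteq d_{w,p}$ isomorphic to $d_{w,p}$, the restriction $T|_Z$ is not an isomorphism. *)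

theory Defs
  imports "HOL-Analysis.Analysis"
begin

text \<open>Real sequences are functions nat => real; indices start at 0, so the
paper's w_1 is w 0 here. Vector operations are written pointwise.\<close>

definition vadd :: "(nat \<Rightarrow> real) \<Rightarrow> (nat \<Rightarrow> real) \<Rightarrow> (nat \<Rightarrow> real)" where
  "vadd x y = (\<lambda>k. x k + y k)"

definition vsmul :: "real \<Rightarrow> (nat \<Rightarrow> real) \<Rightarrow> (nat \<Rightarrow> real)" where
  "vsmul c x = (\<lambda>k. c * x k)"

definition vsub :: "(nat \<Rightarrow> real) \<Rightarrow> (nat \<Rightarrow> real) \<Rightarrow> (nat \<Rightarrow> real)" where
  "vsub x y = (\<lambda>k. x k - y k)"

text \<open>Non-increasing rearrangement of (|x_k|) for x in c_0, via the standard
formula x*_n = inf over sets A with card A \<le> n of sup_{k \<notin> A} |x_k|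
(index n here corresponds to the paper's n+1).\<close>
definition xstar :: "(nat \<Rightarrow> real) \<Rightarrow> nat \<Rightarrow> real" where
  "xstar x n = Inf ((\<lambda>A. Sup ((\<lambda>k. \<bar>x k\<bar>) ` (UNIV - A))) ` {A. finite A \<and> card A \<le> n})"

definition lorentz_space :: "(nat \<Rightarrow> real) \<Rightarrow> real \<Rightarrow> (nat \<Rightarrow> real) set" where
  "lorentz_space w p = {x. x \<longlonglongrightarrow> 0 \<and> summable (\<lambda>n. w n * xstar x n powr p)}"

definition lnorm :: "(nat \<Rightarrow> real) \<Rightarrow> real \<Rightarrow> (nat \<Rightarrow> real) \<Rightarrow> real" where
  "lnorm w p x = (\<Sum>n. w n * xstar x n powr p) powr (1 / p)"

text \<open>Bounded linear operators on d_{w,p}. To make equality of operators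
meaningful, operators are normalised to be 0 outside the space.\<close>
definition Lop :: "(nat \<Rightarrow> real) \<Rightarrow> real \<Rightarrow> ((nat \<Rightarrow> real) \<Rightarrow> (nat \<Rightarrow> real)) set" where
  "Lop w p = {T. (\<forall>x\<in>lorentz_space w p. T x \<in> lorentz_space w p)
     \<and> (\<forall>x\<in>lorentz_space w p. \<forall>y\<in>lorentz_space w p. T (vadd x y) = vadd (T x) (T y))
     \<and> (\<forall>c. \<forall>x\<in>lorentz_space w p. T (vsmul c x) = vsmul c (T x))
     \<and> (\<exists>C. \<forall>x\<in>lorentz_space w p. lnorm w p (T x) \<le> C * lnorm w p x)
     \<and> (\<forall>x. x \<notin> lorentz_space w p \<longrightarrow> T x = (\<lambda>k. 0))}"

definition closed_subspace :: "(nat \<Rightarrow> real) \<Rightarrow> real \<Rightarrow> (nat \<Rightarrow> real) set \<Rightarrow> bool" where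
  "closed_subspace w p Z \<longleftrightarrow> Z \<subseteq> lorentz_space w p \<and> (\<lambda>k. 0) \<in> Z
     \<and> (\<forall>x\<in>Z. \<forall>y\<in>Z. vadd x y \<in> Z) \<and> (\<forall>c. \<forall>x\<in>Z. vsmul c x \<in> Z)
     \<and> (\<forall>X x. (\<forall>n. X n \<in> Z) \<longrightarrow> x \<in> lorentz_space w p
            \<longrightarrow> (\<lambda>n. lnorm w p (vsub (X n) x)) \<longlonglongrightarrow> 0 \<longrightarrow> x \<in> Z)"

definition iso_to_space :: "(nat \<Rightarrow> real) \<Rightarrow> real \<Rightarrow> (nat \<Rightarrow> real) set \<Rightarrow> bool" where
  "iso_to_space w p Z \<longleftrightarrow> (\<exists>U. U ` lorentz_space w p = Z
     \<and> (\<forall>x\<in>lorentz_space w p. \<forall>y\<in>lorentz_space w p. U (vadd x y) = vadd (U x) (U y))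
     \<and> (\<forall>c. \<forall>x\<in>lorentz_space w p. U (vsmul c x) = vsmul c (U x))
     \<and> (\<exists>a b. a > 0 \<and> b > 0 \<and> (\<forall>x\<in>lorentz_space w p.
          a * lnorm w p x \<le> lnorm w p (U x) \<and> lnorm w p (U x) \<le> b * lnorm w p x)))"

text \<open>The restriction of a bounded operator T to Z is an isomorphism (onto its range).\<close>
definition iso_on :: "(nat \<Rightarrow> real) \<Rightarrow> real \<Rightarrow> ((nat \<Rightarrow> real) \<Rightarrow> (nat \<Rightarrow> real)) \<Rightarrow> (nat \<Rightarrow> real) set \<Rightarrow> bool" where
  "iso_on w p T Z \<longleftrightarrow> (\<exists>c>0. \<forall>z\<in>Z. c * lnorm w p z \<le> lnorm w p (T z))"

definition SS :: "(nat \<Rightarrow> real) \<Rightarrow> real \<Rightarrow> ((nat \<Rightarrow> real) \<Rightarrow> (nat \<Rightarrow> real)) set" where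
  "SS w p = {T \<in> Lop w p. \<forall>Z. closed_subspace w p Z \<and> iso_to_space w p Z \<longrightarrow> \<not> iso_on w p T Z}"

definition opadd :: "((nat \<Rightarrow> real) \<Rightarrow> (nat \<Rightarrow> real)) \<Rightarrow> ((nat \<Rightarrow> real) \<Rightarrow> (nat \<Rightarrow> real)) \<Rightarrow> ((nat \<Rightarrow> real) \<Rightarrow> (nat \<Rightarrow> real))" where
  "opadd S T = (\<lambda>x. vadd (S x) (T x))"

definition opsmul :: "real \<Rightarrow> ((nat \<Rightarrow> real) \<Rightarrow> (nat \<Rightarrow> real)) \<Rightarrow> ((nat \<Rightarrow> real) \<Rightarrow> (nat \<Rightarrow> real))" where
  "opsmul c T = (\<lambda>x. vsmul c (T x))"

definition opsub :: "((nat \<Rightarrow> real) \<Rightarrow> (nat \<Rightarrow> real)) \<Rightarrow> ((nat \<Rightarrow> real) \<Rightarrow> (nat \<Rightarrow> real)) \<Rightarrow> ((nat \<Rightarrow> real) \<Rightarrow> (nat \<Rightarrow> real))" where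
  "opsub S T = (\<lambda>x. vsub (S x) (T x))"

definition is_ideal :: "(nat \<Rightarrow> real) \<Rightarrow> real \<Rightarrow> ((nat \<Rightarrow> real) \<Rightarrow> (nat \<Rightarrow> real)) set \<Rightarrow> bool" where
  "is_ideal w p J \<longleftrightarrow> J \<subseteq> Lop w p \<and> (\<lambda>x k. 0) \<in> J
     \<and> (\<forall>S\<in>J. \<forall>T\<in>J. opadd S T \<in> J) \<and> (\<forall>c. \<forall>S\<in>J. opsmul c S \<in> J)
     \<and> (\<forall>S\<in>J. \<forall>A\<in>Lop w p. A \<circ> S \<in> J \<and> S \<circ> A \<in> J)"

definition opnorm :: "(nat \<Rightarrow> real) \<Rightarrow> real \<Rightarrow> ((nat \<Rightarrow> real) \<Rightarrow> (nat \<Rightarrow> real)) \<Rightarrow> real" where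
  "opnorm w p T = Sup {lnorm w p (T x) | x. x \<in> lorentz_space w p \<and> lnorm w p x \<le> 1}"

end

theory Submission
  imports Defs
begin

text \<open>An operator T is strictly singular iff for every operator U the sup norms of T U e_n tend
to 0; every ideal property is read off from this criterion.

If V is bounded and the sup norms of V e_n stay above a positive number along a subsequence, then,
since both the rows and the columns of the matrix of V tend to 0, a sparse submatrix is, after
rescaling, a small perturbation of the identity, so the identity factors through V. On the other hand, if
the norms of V e_n are bounded below while their sup norms tend to 0, then suitably signed sums of
N images have p-th power norm at least cN, whereas a signed sum of N unit vectors has p-th power
norm w_1 + ... + w_N = o(N), contradicting boundedness.

Only the inequality norm (x + y) \<le> 4 (norm x + norm y) is needed, never the exact triangle
inequality or completeness.\<close>

section \<open>Decreasing rearrangements\<close>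

text \<open>Strict singularity speaks about subspaces, and a sum of two operators that fix no copy
  of the space might a priori fix one; this is the obstacle. The criterion removes it, because
  smallness of sup norms passes to sums, multiples and norm limits, and the quantifier over
  \<open>U\<close> absorbs composition on the right. Composition on the left is different: a bounded
  operator need not be bounded for the sup norm, so there the factorization of the identity is used
  instead. The decay of the weights is decisive. With constant weights the space is l_p, where
  normalised, ever flatter disjoint blocks span an isometric copy of the whole space, so norms
  bounded below do not keep sup norms away from 0. Rearrangements mostly stay out of the estimates:
  the p-th power of the norm is the supremum of
  \<open>\<Sum>k<M. w k * \<bar>x (\<sigma> k)\<bar> powr p\<close> over injections
  \<open>\<sigma>\<close>, so an upper bound is checked for each injection and a lower bound needs
  just one.\<close>

lemma null_seq_bdd:
  fixes x :: "nat \<Rightarrow> real"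
  assumes "x \<longlonglongrightarrow> 0"
  shows "bdd_above ((\<lambda>k. \<bar>x k\<bar>) ` B)"
proof -
  have "Bseq x" using assms convergentI convergent_imp_Bseq by blast
  then obtain C where "\<forall>k. norm (x k) \<le> C" by (auto simp: Bseq_def)
  then show ?thesis by (auto intro!: bdd_aboveI[of _ C])
qed

text \<open>An upper bound needs one exceptional set; a lower bound (\<open>xstar_ge\<close>) needs
  a large surviving entry outside every exceptional set. The inf-sup formula is unfolded only in
  these two lemmas.\<close>

lemma xstar_le:
  assumes x: "x \<longlonglongrightarrow> 0" and A: "finite A" "card A \<le> n"
    and le: "\<And>k. k \<notin> A \<Longrightarrow> \<bar>x k\<bar> \<le> c"
  shows "xstar x n \<le> c"
proof -
  let ?f = "\<lambda>A. Sup ((\<lambda>k. \<bar>x k\<bar>) ` (UNIV - A))"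
  have ne: "UNIV - B \<noteq> {}" if "finite B" for B :: "nat set"
    using that infinite_UNIV_nat by (metis Diff_eq_empty_iff finite_subset)
  have nonneg: "0 \<le> ?f B" if B: "finite B" for B
  proof -
    obtain k where "k \<in> UNIV - B" using ne[OF B] by blast
    then have "\<bar>x k\<bar> \<le> ?f B" by (intro cSUP_upper null_seq_bdd x)
    then show ?thesis by linarith
  qed
  have "xstar x n \<le> ?f A"
    unfolding xstar_def using A nonneg by (intro cInf_lower bdd_belowI[of _ 0]) auto
  also have "?f A \<le> c"
    using le by (intro cSUP_least ne A) auto
  finally show ?thesis .
qed

lemma xstar_ge:
  assumes x: "x \<longlonglongrightarrow> 0"
    and ge: "\<And>A. finite A \<Longrightarrow> card A \<le> n \<Longrightarrow> \<exists>k. k \<notin> A \<and> c \<le> \<bar>x k\<bar>"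
  shows "c \<le> xstar x n"
  unfolding xstar_def
proof (rule cINF_greatest)
  have "{} \<in> {A :: nat set. finite A \<and> card A \<le> n}" by simp
  then show "{A. finite A \<and> card A \<le> n} \<noteq> ({} :: nat set set)" by blast
next
  fix A :: "nat set" assume "A \<in> {A. finite A \<and> card A \<le> n}"
  then obtain k where "k \<in> UNIV - A" "c \<le> \<bar>x k\<bar>" using ge by blast
  then show "c \<le> Sup ((\<lambda>k. \<bar>x k\<bar>) ` (UNIV - A))"
    by (intro cSUP_upper2 null_seq_bdd x)
qed

lemma null_seq_attains_max:
  fixes x :: "nat \<Rightarrow> real"
  assumes x: "x \<longlonglongrightarrow> 0" and B: "B \<noteq> {}"
  shows "\<exists>m\<in>B. \<forall>k\<in>B. \<bar>x k\<bar> \<le> \<bar>x m\<bar>"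
proof (cases "\<forall>k\<in>B. x k = 0")
  case True then show ?thesis using B by auto
next
  case False
  then obtain b where b: "b \<in> B" "x b \<noteq> 0" by blast
  have "eventually (\<lambda>k. \<bar>x k\<bar> < \<bar>x b\<bar>) sequentially"
    using x b tendsto_rabs_zero[OF x] by (intro order_tendstoD) auto
  then obtain n0 where n0: "\<And>k. k \<ge> n0 \<Longrightarrow> \<bar>x k\<bar> < \<bar>x b\<bar>"
    by (auto simp: eventually_sequentially)
  \<comment> \<open>Entries beyond \<open>n0\<close> are smaller than the nonzero entry at
    \<open>b\<close>, so a maximum over this finite part is a maximum over \<open>B\<close>.\<close>
  let ?F = "B \<inter> {..n0}"
  have bF: "b \<in> ?F" using b n0[of b] by force
  obtain m where m: "m \<in> ?F" "\<forall>k\<in>?F. \<bar>x k\<bar> \<le> \<bar>x m\<bar>"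
    using obtains_MAX[of ?F "\<lambda>k. \<bar>x k\<bar>"] bF
    by (metis (no_types, lifting) Max_ge empty_iff finite_Int finite_atMost finite_imageI imageI)
  have "\<bar>x k\<bar> \<le> \<bar>x m\<bar>" if "k \<in> B" for k
  proof (cases "k \<le> n0")
    case True then show ?thesis using m that by auto
  next
    case False
    then have "\<bar>x k\<bar> < \<bar>x b\<bar>" using n0 by simp
    moreover have "\<bar>x b\<bar> \<le> \<bar>x m\<bar>" using m(2) bF by blast
    ultimately show ?thesis by linarith
  qed
  then show ?thesis using m by blast
qed

text \<open>Greedy choice: always take a largest entry among the positions not yet used. The
  enumeration need not be onto: if infinitely many entries are nonzero, the zero entries are never
  reached.\<close>

lemma xstar_enumeration:
  assumes x: "x \<longlonglongrightarrow> 0"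
  shows "\<exists>\<sigma>. inj \<sigma> \<and> (\<forall>k. xstar x k = \<bar>x (\<sigma> k)\<bar>)"
proof -
  have "\<exists>\<sigma>. \<forall>k::nat. \<sigma> k \<notin> \<sigma> ` {..<k} \<and> (\<forall>m. m \<notin> \<sigma> ` {..<k} \<longrightarrow> \<bar>x m\<bar> \<le> \<bar>x (\<sigma> k)\<bar>)"
  proof (rule dependent_wellorder_choice[where P = "\<lambda>f k r. r \<notin> f ` {..<k} \<and> (\<forall>m. m \<notin> f ` {..<k} \<longrightarrow> \<bar>x m\<bar> \<le> \<bar>x r\<bar>)"])
    fix r and f g :: "nat \<Rightarrow> nat" and k :: nat
    assume "\<And>y. y < k \<Longrightarrow> f y = g y"
    then have "f ` {..<k} = g ` {..<k}" by (intro image_cong) auto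
    then show "(r \<notin> f ` {..<k} \<and> (\<forall>m. m \<notin> f ` {..<k} \<longrightarrow> \<bar>x m\<bar> \<le> \<bar>x r\<bar>)) =
      (r \<notin> g ` {..<k} \<and> (\<forall>m. m \<notin> g ` {..<k} \<longrightarrow> \<bar>x m\<bar> \<le> \<bar>x r\<bar>))" by simp
  next
    fix k :: nat and f :: "nat \<Rightarrow> nat"
    have "- f ` {..<k} \<noteq> {}"
      by (metis Compl_empty_eq double_compl finite_imageI finite_lessThan infinite_UNIV_nat)
    from null_seq_attains_max[OF x this]
    show "\<exists>r. r \<notin> f ` {..<k} \<and> (\<forall>m. m \<notin> f ` {..<k} \<longrightarrow> \<bar>x m\<bar> \<le> \<bar>x r\<bar>)" by auto
  qed
  then obtain \<sigma> :: "nat \<Rightarrow> nat" where fresh: "\<And>k. \<sigma> k \<notin> \<sigma> ` {..<k}"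
    and max: "\<And>k m. m \<notin> \<sigma> ` {..<k} \<Longrightarrow> \<bar>x m\<bar> \<le> \<bar>x (\<sigma> k)\<bar>" by blast
  have inj: "inj \<sigma>"
  proof (rule linorder_injI)
    fix i j :: nat assume "i < j"
    then show "\<sigma> i \<noteq> \<sigma> j" using fresh[of j] by (metis imageI lessThan_iff)
  qed
  have "xstar x k = \<bar>x (\<sigma> k)\<bar>" for k
  proof (rule antisym)
    show "xstar x k \<le> \<bar>x (\<sigma> k)\<bar>"
      using max by (intro xstar_le[OF x, of "\<sigma> ` {..<k}"])
        (auto intro: order_trans[OF card_image_le])
    show "\<bar>x (\<sigma> k)\<bar> \<le> xstar x k"
    proof (rule xstar_ge[OF x])
      fix A :: "nat set" assume A: "finite A" "card A \<le> k"
      have "card (\<sigma> ` {..k}) = Suc k"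
        using inj by (simp add: card_image inj_on_subset)
      then have "\<not> \<sigma> ` {..k} \<subseteq> A" using A card_mono[OF A(1), of "\<sigma> ` {..k}"] by linarith
      then obtain i where i: "i \<le> k" "\<sigma> i \<notin> A" by auto
      \<comment> \<open>Since \<open>i \<le> k\<close>, position \<open>\<sigma> k\<close> was still
        available when \<open>\<sigma> i\<close> was chosen, so the entry at
        \<open>\<sigma> i\<close> is at least as large.\<close>
      have "\<sigma> k \<notin> \<sigma> ` {..<i}" using i inj by (auto simp: inj_eq)
      then show "\<exists>m. m \<notin> A \<and> \<bar>x (\<sigma> k)\<bar> \<le> \<bar>x m\<bar>" using i max by blast
    qed
  qed
  then show ?thesis using inj by blast
qed

lemma xstar_nonneg: "x \<longlonglongrightarrow> 0 \<Longrightarrow> 0 \<le> xstar x n"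
  by (metis abs_ge_zero xstar_enumeration)

lemma xstar_mono:
  assumes x: "x \<longlonglongrightarrow> 0" and y: "y \<longlonglongrightarrow> 0" and le: "\<And>k. \<bar>y k\<bar> \<le> \<bar>x k\<bar>"
  shows "xstar y n \<le> xstar x n"
proof (rule xstar_ge[OF x])
  fix A :: "nat set" assume A: "finite A" "card A \<le> n"
  show "\<exists>k. k \<notin> A \<and> xstar y n \<le> \<bar>x k\<bar>"
  proof (rule ccontr)
    assume H: "\<nexists>k. k \<notin> A \<and> xstar y n \<le> \<bar>x k\<bar>"
    have "- A \<noteq> {}" using A(1) infinite_UNIV_nat by (metis Compl_empty_eq double_compl)
    from null_seq_attains_max[OF x this] obtain m where
      m: "m \<notin> A" "\<And>k. k \<notin> A \<Longrightarrow> \<bar>x k\<bar> \<le> \<bar>x m\<bar>" by auto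
    have "xstar y n \<le> \<bar>x m\<bar>"
      using m le by (intro xstar_le[OF y A]) (meson order_trans)
    with H m show False by blast
  qed
qed

text \<open>A smallest entry of \<open>F\<close> is matched with the last term on the right:
  \<open>m\<close> exceptional positions cannot cover the \<open>Suc m\<close> elements of
  \<open>F\<close>, so \<open>xstar x m\<close> is at least that entry.\<close>

lemma sum_powr_le_xstar:
  assumes x: "x \<longlonglongrightarrow> 0" and p: "0 \<le> p" and F: "finite F" "card F = m"
  shows "(\<Sum>k\<in>F. \<bar>x k\<bar> powr p) \<le> (\<Sum>k<m. xstar x k powr p)"
  using F
proof (induction m arbitrary: F)
  case 0 then show ?case by simp
next
  case (Suc m)
  then have "F \<noteq> {}" by (metis card.empty nat.distinct(1))
  then obtain f where f: "f \<in> F" "\<And>k. k \<in> F \<Longrightarrow> \<bar>x f\<bar> \<le> \<bar>x k\<bar>"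
    using ex_is_arg_min_if_finite[of F "\<lambda>k. \<bar>x k\<bar>"] Suc.prems(1)
    unfolding is_arg_min_linorder by blast
  have "\<bar>x f\<bar> \<le> xstar x m"
  proof (rule xstar_ge[OF x])
    fix A :: "nat set" assume A: "finite A" "card A \<le> m"
    then have "\<not> F \<subseteq> A" using card_mono[OF A(1), of F] Suc.prems(2) by linarith
    then show "\<exists>k. k \<notin> A \<and> \<bar>x f\<bar> \<le> \<bar>x k\<bar>" using f by auto
  qed
  then have "\<bar>x f\<bar> powr p \<le> xstar x m powr p" using p by (intro powr_mono2) auto
  moreover have "(\<Sum>k\<in>F - {f}. \<bar>x k\<bar> powr p) \<le> (\<Sum>k<m. xstar x k powr p)"
    using Suc f by (intro Suc.IH) auto
  moreover have "(\<Sum>k\<in>F. \<bar>x k\<bar> powr p) = \<bar>x f\<bar> powr p + (\<Sum>k\<in>F - {f}. \<bar>x k\<bar> powr p)"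
    using Suc f by (intro sum.remove) auto
  ultimately show ?case by simp
qed

text \<open>Abel summation in inductive form: the invariant
  \<open>w m * (\<Sum>k<m. c k) \<le> (\<Sum>k<m. w k * c k)\<close> survives lowering the weight
  because the partial sums of \<open>c\<close> are nonnegative.\<close>

lemma antimono_weighted_sum_le:
  fixes w a b :: "nat \<Rightarrow> real"
  assumes w: "antimono w" "\<And>n. 0 \<le> w n"
    and le: "\<And>m. (\<Sum>k<m. a k) \<le> (\<Sum>k<m. b k)"
  shows "(\<Sum>k<m. w k * a k) \<le> (\<Sum>k<m. w k * b k)"
proof -
  define c where "c k = b k - a k" for k
  have c: "0 \<le> (\<Sum>k<m. c k)" for m using le[of m] by (simp add: c_def sum_subtractf)
  have "w m * (\<Sum>k<m. c k) \<le> (\<Sum>k<m. w k * c k)" for m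
  proof (induction m)
    case 0 then show ?case by simp
  next
    case (Suc m)
    have "w (Suc m) * (\<Sum>k<Suc m. c k) \<le> w m * (\<Sum>k<Suc m. c k)"
      using c[of "Suc m"] antimonoD[OF w(1), of m "Suc m"] by (intro mult_right_mono) auto
    also have "\<dots> \<le> (\<Sum>k<Suc m. w k * c k)" using Suc by (simp add: algebra_simps)
    finally show ?case .
  qed
  then have "0 \<le> (\<Sum>k<m. w k * c k)"
    using c w(2) by (meson mult_nonneg_nonneg order_trans)
  then show ?thesis by (simp add: c_def sum_subtractf algebra_simps)
qed

text \<open>A Hardy-Littlewood inequality. Extended by zero off \<open>S\<close>, the left-hand
  sequence has partial sums dominated by those of the rearrangement, and decreasing weights preserve
  this. Gaps in \<open>S\<close> are allowed because later sums leave out some indices.\<close>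

lemma rearrangement_sum_le:
  assumes x: "x \<longlonglongrightarrow> 0" and p: "0 \<le> p" and w: "antimono w" "\<And>n. 0 \<le> w n"
    and S: "S \<subseteq> {..<M}" "inj_on \<sigma> S"
  shows "(\<Sum>k\<in>S. w k * \<bar>x (\<sigma> k)\<bar> powr p) \<le> (\<Sum>k<M. w k * xstar x k powr p)"
proof -
  define a where "a k = (if k \<in> S then \<bar>x (\<sigma> k)\<bar> powr p else 0)" for k
  have "(\<Sum>k<m. a k) \<le> (\<Sum>k<m. xstar x k powr p)" for m
  proof -
    have "(\<Sum>k<m. a k) = (\<Sum>k\<in>{..<m} \<inter> S. \<bar>x (\<sigma> k)\<bar> powr p)"
      unfolding a_def by (simp add: sum.inter_restrict)
    also have "\<dots> = (\<Sum>k\<in>\<sigma> ` ({..<m} \<inter> S). \<bar>x k\<bar> powr p)"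
      using S by (subst sum.reindex) (auto intro: inj_on_subset)
    also have "\<dots> \<le> (\<Sum>k<card (\<sigma> ` ({..<m} \<inter> S)). xstar x k powr p)"
      by (intro sum_powr_le_xstar x p) auto
    also have "\<dots> \<le> (\<Sum>k<m. xstar x k powr p)"
    proof (rule sum_mono2)
      have "card (\<sigma> ` ({..<m} \<inter> S)) \<le> card ({..<m} \<inter> S)" by (intro card_image_le) auto
      also have "\<dots> \<le> card {..<m}" by (intro card_mono) auto
      finally show "{..<card (\<sigma> ` ({..<m} \<inter> S))} \<subseteq> {..<m}" by auto
    qed auto
    finally show ?thesis .
  qed
  from antimono_weighted_sum_le[OF w this]
  have "(\<Sum>k<M. w k * a k) \<le> (\<Sum>k<M. w k * xstar x k powr p)" .
  also have "(\<Sum>k<M. w k * a k) = (\<Sum>k\<in>{..<M} \<inter> S. w k * \<bar>x (\<sigma> k)\<bar> powr p)"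
    unfolding a_def by (subst sum.inter_restrict) (auto intro: sum.cong)
  also have "{..<M} \<inter> S = S" using S by auto
  finally show ?thesis .
qed

section \<open>The space\<close>

definition unit_seq :: "nat \<Rightarrow> nat \<Rightarrow> real" where
  "unit_seq n = (\<lambda>k. if k = n then 1 else 0)"

definition head_seq :: "nat \<Rightarrow> (nat \<Rightarrow> real) \<Rightarrow> nat \<Rightarrow> real" where
  "head_seq L x = (\<lambda>k. if k < L then x k else 0)"

definition tail_seq :: "nat \<Rightarrow> (nat \<Rightarrow> real) \<Rightarrow> nat \<Rightarrow> real" where
  "tail_seq L x = (\<lambda>k. if k < L then 0 else x k)"

lemma head_add_tail: "vadd (head_seq L x) (tail_seq L x) = x"
  by (auto simp: vadd_def head_seq_def tail_seq_def)

lemma abs_add_powr_le: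
  fixes a b :: real
  assumes "1 \<le> p"
  shows "\<bar>a + b\<bar> powr p \<le> 2 powr p * (\<bar>a\<bar> powr p + \<bar>b\<bar> powr p)"
proof -
  have "\<bar>a + b\<bar> powr p \<le> (2 * max \<bar>a\<bar> \<bar>b\<bar>) powr p"
    using assms by (intro powr_mono2) auto
  also have "\<dots> = 2 powr p * max \<bar>a\<bar> \<bar>b\<bar> powr p" by (simp add: powr_mult)
  also have "\<dots> \<le> 2 powr p * (\<bar>a\<bar> powr p + \<bar>b\<bar> powr p)"
    by (intro mult_left_mono) (auto simp: max_def)
  finally show ?thesis .
qed

lemma null_seq_supported_finite:
  fixes z :: "nat \<Rightarrow> real"
  assumes "finite F" "\<And>k. k \<notin> F \<Longrightarrow> z k = 0"
  shows "z \<longlonglongrightarrow> 0"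
proof (rule tendsto_eventually)
  have "\<forall>\<^sub>F k in cofinite. k \<notin> F" using assms(1) by (simp add: eventually_cofinite)
  then have "\<forall>\<^sub>F k in sequentially. k \<notin> F" by (simp add: cofinite_eq_sequentially)
  then show "\<forall>\<^sub>F k in sequentially. z k = 0" by eventually_elim (rule assms)
qed

section \<open>The p-th power of the norm as a supremum over injections\<close>

locale lorentz =
  fixes w :: "nat \<Rightarrow> real" and p :: real
  assumes p: "1 \<le> p"
    and w0: "w 0 = 1"
    and wdec: "antimono w"
    and wlim: "w \<longlonglongrightarrow> 0"
begin

abbreviation "lsp \<equiv> lorentz_space w p"
abbreviation "nrm \<equiv> lnorm w p"

text \<open>On the space this is the p-th power of the norm (\<open>modular_eq\<close>). Estimates
  are made for it by adding terms, and the root is taken last.\<close>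

definition modular :: "(nat \<Rightarrow> real) \<Rightarrow> real" where
  "modular x = (\<Sum>n. w n * xstar x n powr p)"

lemma w_nonneg: "0 \<le> w n"
  using decseq_ge[OF wdec wlim] .

lemma w_le_1: "w n \<le> 1"
  using antimonoD[OF wdec, of 0 n] w0 by simp

lemma p_pos: "0 < p" using p by simp

lemma lsp_null: "x \<in> lsp \<Longrightarrow> x \<longlonglongrightarrow> 0"
  by (simp add: lorentz_space_def)

text \<open>The enumeration behind the rearrangement is itself an injection, so bounds over all
  injections suffice. Together with \<open>sum_le_modular\<close> this exhibits
  \<open>modular\<close> as a supremum, and the rearrangement of a newly built sequence never has to
  be computed.\<close>

lemma lspI:
  assumes x: "x \<longlonglongrightarrow> 0"
    and le: "\<And>M \<sigma>. inj_on \<sigma> {..<M} \<Longrightarrow> (\<Sum>k<M. w k * \<bar>x (\<sigma> k)\<bar> powr p) \<le> C"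
  shows "x \<in> lsp" "modular x \<le> C"
proof -
  obtain \<sigma> where \<sigma>: "inj \<sigma>" "\<And>k. xstar x k = \<bar>x (\<sigma> k)\<bar>"
    using xstar_enumeration[OF x] by blast
  have nn: "0 \<le> w n * xstar x n powr p" for n using w_nonneg by simp
  have bd: "(\<Sum>k<M. w k * xstar x k powr p) \<le> C" for M
    unfolding \<sigma>(2) using \<sigma>(1) by (intro le) (auto intro: inj_on_subset)
  have s: "summable (\<lambda>n. w n * xstar x n powr p)"
    using nn bd by (rule summableI_nonneg_bounded)
  show "x \<in> lsp" using s x by (simp add: lorentz_space_def)
  show "modular x \<le> C" unfolding modular_def using s bd by (rule suminf_le_const)
qed

lemma sum_le_modular:
  assumes x: "x \<in> lsp" and S: "finite S" "inj_on \<sigma> S"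
  shows "(\<Sum>k\<in>S. w k * \<bar>x (\<sigma> k)\<bar> powr p) \<le> modular x"
proof -
  obtain M where M: "S \<subseteq> {..<M}" using S finite_nat_iff_bounded by blast
  have "(\<Sum>k\<in>S. w k * \<bar>x (\<sigma> k)\<bar> powr p) \<le> (\<Sum>k<M. w k * xstar x k powr p)"
    using S M p_pos by (intro rearrangement_sum_le lsp_null x wdec w_nonneg) auto
  also have "\<dots> \<le> modular x"
    unfolding modular_def using x w_nonneg
    by (intro sum_le_suminf) (auto simp: lorentz_space_def)
  finally show ?thesis .
qed

lemma modular_nonneg: "x \<in> lsp \<Longrightarrow> 0 \<le> modular x"
  using sum_le_modular[of x "{}" id] by simp

lemma nrm_nonneg: "0 \<le> nrm x"
  by (simp add: lnorm_def)

lemma modular_eq: "x \<in> lsp \<Longrightarrow> modular x = nrm x powr p"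
  using modular_nonneg[of x] p_pos by (simp add: lnorm_def modular_def powr_powr)

lemma nrm_le:
  assumes "x \<in> lsp" "0 \<le> c" "modular x \<le> c powr p"
  shows "nrm x \<le> c"
  using assms p_pos by (metis modular_eq nrm_nonneg powr_less_mono2 not_less)

lemma abs_le_nrm:
  assumes "x \<in> lsp"
  shows "\<bar>x k\<bar> \<le> nrm x"
proof -
  \<comment> \<open>A one-term sum: position \<open>k\<close> is placed at index 0, where the weight
    is 1.\<close>
  have "\<bar>x k\<bar> powr p \<le> nrm x powr p"
    using sum_le_modular[OF assms, of "{0}" "\<lambda>_. k"] w0 modular_eq[OF assms] by simp
  then show ?thesis using p_pos nrm_nonneg by (metis abs_ge_zero powr_less_mono2 not_less)
qed

lemma modular_le_nrm_le:
  assumes "x \<in> lsp" "y \<in> lsp" "0 \<le> c" "modular y \<le> c powr p * modular x"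
  shows "nrm y \<le> c * nrm x"
  using assms by (intro nrm_le) (auto simp: modular_eq powr_mult nrm_nonneg)

section \<open>Domination, quasi-norm inequality and passage to subsequences\<close>

lemma lsp_dominated:
  assumes x: "x \<in> lsp" and le: "\<And>k. \<bar>y k\<bar> \<le> \<bar>x k\<bar>"
  shows "y \<in> lsp" "nrm y \<le> nrm x"
proof -
  have y: "y \<longlonglongrightarrow> 0"
    by (rule Lim_null_comparison[OF _ tendsto_rabs_zero[OF lsp_null[OF x]]]) (simp add: le)
  have *: "(\<Sum>k<M. w k * \<bar>y (\<sigma> k)\<bar> powr p) \<le> modular x" if "inj_on \<sigma> {..<M}" for M \<sigma>
  proof -
    have "(\<Sum>k<M. w k * \<bar>y (\<sigma> k)\<bar> powr p) \<le> (\<Sum>k<M. w k * \<bar>x (\<sigma> k)\<bar> powr p)"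
      using le w_nonneg p_pos by (intro sum_mono mult_left_mono powr_mono2) auto
    also have "\<dots> \<le> modular x" using that by (intro sum_le_modular x) auto
    finally show ?thesis .
  qed
  show "y \<in> lsp" using lspI(1)[OF y] * by blast
  then show "nrm y \<le> nrm x" using modular_le_nrm_le[OF x, of y 1] lspI(2)[OF y] * by simp
qed

lemma lsp_add:
  assumes x: "x \<in> lsp" and y: "y \<in> lsp"
  shows "vadd x y \<in> lsp" "nrm (vadd x y) \<le> 4 * (nrm x + nrm y)"
proof -
  have z: "vadd x y \<longlonglongrightarrow> 0"
    using tendsto_add[OF lsp_null[OF x] lsp_null[OF y]] by (simp add: vadd_def)
  have *: "(\<Sum>k<M. w k * \<bar>vadd x y (\<sigma> k)\<bar> powr p) \<le> 2 powr p * (modular x + modular y)"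
    if "inj_on \<sigma> {..<M}" for M \<sigma>
  proof -
    have "(\<Sum>k<M. w k * \<bar>vadd x y (\<sigma> k)\<bar> powr p)
        \<le> (\<Sum>k<M. w k * (2 powr p * (\<bar>x (\<sigma> k)\<bar> powr p + \<bar>y (\<sigma> k)\<bar> powr p)))"
      unfolding vadd_def using abs_add_powr_le[OF p] w_nonneg by (intro sum_mono mult_left_mono)
    also have "\<dots> = 2 powr p * ((\<Sum>k<M. w k * \<bar>x (\<sigma> k)\<bar> powr p) + (\<Sum>k<M. w k * \<bar>y (\<sigma> k)\<bar> powr p))"
      by (simp add: sum.distrib[symmetric] sum_distrib_left algebra_simps)
    also have "\<dots> \<le> 2 powr p * (modular x + modular y)"
      using that by (intro mult_left_mono add_mono sum_le_modular x y) auto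
    finally show ?thesis .
  qed
  show m: "vadd x y \<in> lsp" using lspI(1)[OF z] * by blast
  have "modular (vadd x y) \<le> 2 powr p * (modular x + modular y)" using lspI(2)[OF z] * by blast
  also have "\<dots> \<le> 2 powr p * ((nrm x + nrm y) powr p + (nrm x + nrm y) powr p)"
    unfolding modular_eq[OF x] modular_eq[OF y] using p_pos nrm_nonneg
    by (intro mult_left_mono add_mono powr_mono2) auto
  \<comment> \<open>The two equal summands give a second factor 2, enlarged to
    \<open>2 powr p\<close> so that the root is 2 * 2 = 4 for every \<open>p\<close>.\<close>
  also have "\<dots> = 2 powr p * (2 powr 1 * (nrm x + nrm y) powr p)" by simp
  also have "\<dots> \<le> 2 powr p * (2 powr p * (nrm x + nrm y) powr p)"
    using p by (intro mult_left_mono mult_right_mono powr_mono) auto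
  also have "\<dots> = (2 * (2 * (nrm x + nrm y))) powr p"
    using nrm_nonneg[of x] nrm_nonneg[of y] by (simp only: powr_mult)
  finally have "modular (vadd x y) \<le> (2 * (2 * (nrm x + nrm y))) powr p" .
  then have "nrm (vadd x y) \<le> 2 * (2 * (nrm x + nrm y))"
    using nrm_nonneg[of x] nrm_nonneg[of y] by (intro nrm_le m) auto
  then show "nrm (vadd x y) \<le> 4 * (nrm x + nrm y)" by simp
qed

lemma lsp_smul:
  assumes x: "x \<in> lsp"
  shows "vsmul c x \<in> lsp" "nrm (vsmul c x) \<le> \<bar>c\<bar> * nrm x"
proof -
  have z: "vsmul c x \<longlonglongrightarrow> 0"
    using tendsto_mult_right_zero[OF lsp_null[OF x], of c] by (simp add: vsmul_def)
  have *: "(\<Sum>k<M. w k * \<bar>vsmul c x (\<sigma> k)\<bar> powr p) \<le> \<bar>c\<bar> powr p * modular x"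
    if "inj_on \<sigma> {..<M}" for M \<sigma>
  proof -
    have "(\<Sum>k<M. w k * \<bar>vsmul c x (\<sigma> k)\<bar> powr p) = \<bar>c\<bar> powr p * (\<Sum>k<M. w k * \<bar>x (\<sigma> k)\<bar> powr p)"
      by (simp add: vsmul_def sum_distrib_left abs_mult powr_mult algebra_simps)
    also have "\<dots> \<le> \<bar>c\<bar> powr p * modular x"
      using that by (intro mult_left_mono sum_le_modular x) auto
    finally show ?thesis .
  qed
  show "vsmul c x \<in> lsp" using lspI(1)[OF z] * by blast
  then show "nrm (vsmul c x) \<le> \<bar>c\<bar> * nrm x"
    using modular_le_nrm_le[OF x, of "vsmul c x" "\<bar>c\<bar>"] lspI(2)[OF z] * by simp
qed

lemma lsp_sub:
  assumes x: "x \<in> lsp" and y: "y \<in> lsp"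
  shows "vsub x y \<in> lsp" "nrm (vsub x y) \<le> 4 * (nrm x + nrm y)"
proof -
  have eq: "vsub x y = vadd x (vsmul (-1) y)" by (simp add: vsub_def vadd_def vsmul_def)
  show "vsub x y \<in> lsp" unfolding eq by (intro lsp_add lsp_smul x y)
  have "nrm (vsub x y) \<le> 4 * (nrm x + nrm (vsmul (-1) y))"
    unfolding eq by (intro lsp_add lsp_smul x y)
  also have "nrm (vsmul (-1) y) \<le> nrm y" using lsp_smul(2)[OF y, of "-1"] by simp
  finally show "nrm (vsub x y) \<le> 4 * (nrm x + nrm y)" by simp
qed

text \<open>The norm sees entries only up to injections of positions: composing an injection with
  \<open>j\<close> keeps it injective. In \<open>lsp_spread\<close> the same is done with the
  inverse of \<open>j\<close>, on those indices that hit its range.\<close>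

lemma lsp_reindex:
  assumes x: "x \<in> lsp" and j: "strict_mono j"
  shows "(\<lambda>i. x (j i)) \<in> lsp" "nrm (\<lambda>i. x (j i)) \<le> nrm x"
proof -
  have z: "(\<lambda>i. x (j i)) \<longlonglongrightarrow> 0"
    using LIMSEQ_subseq_LIMSEQ[OF lsp_null[OF x] j] by (simp add: o_def)
  have *: "(\<Sum>k<M. w k * \<bar>x (j (\<sigma> k))\<bar> powr p) \<le> modular x" if "inj_on \<sigma> {..<M}" for M \<sigma>
    using that strict_mono_eq[OF j] sum_le_modular[OF x, of "{..<M}" "\<lambda>k. j (\<sigma> k)"]
    by (simp add: inj_on_def)
  show "(\<lambda>i. x (j i)) \<in> lsp" using lspI(1)[OF z] * by blast
  then show "nrm (\<lambda>i. x (j i)) \<le> nrm x"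
    using modular_le_nrm_le[OF x, of "\<lambda>i. x (j i)" 1] lspI(2)[OF z] * by simp
qed

lemma lsp_spread:
  assumes x: "x \<in> lsp" and j: "strict_mono j"
  defines "y \<equiv> \<lambda>k. if k \<in> range j then x (inv j k) else 0"
  shows "y \<in> lsp" "nrm y \<le> nrm x"
proof -
  have inj: "inj j" using strict_mono_imp_inj_on[OF j] .
  have z: "y \<longlonglongrightarrow> 0"
  proof (rule LIMSEQ_I)
    fix r :: real assume "0 < r"
    then obtain n0 where n0: "\<And>n. n \<ge> n0 \<Longrightarrow> norm (x n) < r"
      using LIMSEQ_D[OF lsp_null[OF x]] by fastforce
    have "norm (y k) < r" if k: "k \<ge> j n0" for k
    proof (cases "k \<in> range j")
      case True
      then obtain i where i: "k = j i" by blast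
      then have "n0 \<le> i" using k strict_mono_less_eq[OF j] by blast
      then show ?thesis using n0 inj i by (simp add: y_def)
    next
      case False then show ?thesis using \<open>0 < r\<close> by (simp add: y_def)
    qed
    then show "\<exists>no. \<forall>n\<ge>no. norm (y n - 0) < r" by auto
  qed
  have *: "(\<Sum>k<M. w k * \<bar>y (\<sigma> k)\<bar> powr p) \<le> modular x" if \<sigma>: "inj_on \<sigma> {..<M}" for M \<sigma>
  proof -
    let ?S = "{k\<in>{..<M}. \<sigma> k \<in> range j}"
    have "(\<Sum>k<M. w k * \<bar>y (\<sigma> k)\<bar> powr p) = (\<Sum>k\<in>?S. w k * \<bar>y (\<sigma> k)\<bar> powr p)"
      by (intro sum.mono_neutral_right) (auto simp: y_def)
    also have "\<dots> = (\<Sum>k\<in>?S. w k * \<bar>x (inv j (\<sigma> k))\<bar> powr p)"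
      by (intro sum.cong) (auto simp: y_def)
    also have "\<dots> \<le> modular x"
    proof (rule sum_le_modular[OF x, of ?S "\<lambda>k. inv j (\<sigma> k)"])
      show "inj_on (\<lambda>k. inv j (\<sigma> k)) ?S"
      proof (rule inj_onI)
        fix a b assume ab: "a \<in> ?S" "b \<in> ?S" "inv j (\<sigma> a) = inv j (\<sigma> b)"
        then have "\<sigma> a = \<sigma> b" by (metis (mono_tags, lifting) f_inv_into_f mem_Collect_eq)
        then show "a = b" using ab \<sigma> by (auto dest: inj_onD)
      qed
    qed auto
    finally show ?thesis .
  qed
  show "y \<in> lsp" using lspI(1)[OF z] * by blast
  then show "nrm y \<le> nrm x"
    using modular_le_nrm_le[OF x, of y 1] lspI(2)[OF z] * by simp
qed

text \<open>The rearrangement vanishes from index \<open>card F\<close> on, so the series is a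
  finite sum. The bound in the second part is the p-th power of the fundamental function of the unit
  vector basis.\<close>

lemma finite_support:
  assumes F: "finite F" and z: "\<And>k. k \<notin> F \<Longrightarrow> z k = 0"
  shows "z \<in> lsp" and "(\<And>k. \<bar>z k\<bar> \<le> 1) \<Longrightarrow> modular z \<le> (\<Sum>k<card F. w k)"
proof -
  have n: "z \<longlonglongrightarrow> 0" using null_seq_supported_finite[OF assms] .
  have "xstar z k \<le> 0" if "card F \<le> k" for k
    using z by (intro xstar_le[OF n F that]) simp
  then have 0: "xstar z k = 0" if "k \<notin> {..<card F}" for k
    using that xstar_nonneg[OF n, of k] by (simp add: order_antisym)
  have s: "(\<lambda>k. w k * xstar z k powr p) sums (\<Sum>k<card F. w k * xstar z k powr p)"
    using 0 by (intro sums_finite) auto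
  show "z \<in> lsp" using s n by (auto simp: lorentz_space_def sums_iff)
  assume le: "\<And>k. \<bar>z k\<bar> \<le> 1"
  have "xstar z k \<le> 1" for k
    using le by (intro xstar_le[OF n, of "{}"]) auto
  then have "xstar z k powr p \<le> 1" for k
    using xstar_nonneg[OF n] p_pos by (intro powr_le1) auto
  then have "w k * xstar z k powr p \<le> w k" for k
    using w_nonneg mult_left_mono[of "xstar z k powr p" 1 "w k"] by simp
  then show "modular z \<le> (\<Sum>k<card F. w k)"
    using s sum_mono[of "{..<card F}" "\<lambda>k. w k * xstar z k powr p" w]
    by (simp add: modular_def sums_iff)
qed

lemma unit_seq_lsp: "unit_seq n \<in> lsp"
  by (rule finite_support[of "{n}"]) (auto simp: unit_seq_def)

lemma nrm_unit_seq: "nrm (unit_seq n) = 1"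
proof (rule antisym)
  have "modular (unit_seq n) \<le> (\<Sum>k<card {n}. w k)"
    by (rule finite_support(2)) (auto simp: unit_seq_def)
  then show "nrm (unit_seq n) \<le> 1"
    using w0 by (intro nrm_le unit_seq_lsp) auto
  show "1 \<le> nrm (unit_seq n)"
    using abs_le_nrm[OF unit_seq_lsp, of n n] by (simp add: unit_seq_def)
qed

lemma head_seq_lsp: "head_seq L x \<in> lsp"
  by (rule finite_support[of "{..<L}"]) (auto simp: head_seq_def)

lemma zero_lsp: "(\<lambda>k. 0) \<in> lsp"
  by (rule finite_support[of "{}"]) auto

lemma tail_seq_lsp: "x \<in> lsp \<Longrightarrow> tail_seq L x \<in> lsp"
  by (rule lsp_dominated(1)[of x]) (auto simp: tail_seq_def)

lemma nrm_zero: "nrm (\<lambda>k. 0) = 0"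
proof (rule antisym)
  have "modular (\<lambda>k. 0) \<le> (\<Sum>k<card ({}::nat set). w k)"
    by (rule finite_support(2)) auto
  then show "nrm (\<lambda>k. 0) \<le> 0" using p_pos by (intro nrm_le zero_lsp) auto
qed (rule nrm_nonneg)

text \<open>A fixed element used later to dominate the remainder of a Neumann series, which yields
  membership and a norm bound at once.\<close>

lemma geometric_lsp: "(\<lambda>k. (1/2) ^ k) \<in> lsp"
proof (rule lspI)
  show "(\<lambda>k. (1/2) ^ k :: real) \<longlonglongrightarrow> 0" by (intro LIMSEQ_power_zero) auto
  fix M and \<sigma> :: "nat \<Rightarrow> nat" assume \<sigma>: "inj_on \<sigma> {..<M}"
  have "w k * \<bar>(1/2) ^ \<sigma> k\<bar> powr p \<le> (1/2) ^ \<sigma> k" for k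
  proof -
    have "\<bar>(1/2) ^ \<sigma> k\<bar> powr p \<le> ((1/2) ^ \<sigma> k :: real) powr 1"
      using p by (simp only: abs_of_nonneg zero_le_power zero_le_divide_1_iff zero_le_numeral)
        (intro powr_mono', auto simp: power_le_one)
    then have "\<bar>(1/2) ^ \<sigma> k\<bar> powr p \<le> ((1/2) ^ \<sigma> k :: real)" by simp
    then show ?thesis using w_nonneg[of k] w_le_1[of k] mult_mono[of "w k" 1] by fastforce
  qed
  then have "(\<Sum>k<M. w k * \<bar>(1/2) ^ \<sigma> k\<bar> powr p) \<le> (\<Sum>k<M. (1/2) ^ \<sigma> k)"
    by (intro sum_mono)
  also have "\<dots> = (\<Sum>k\<in>\<sigma> ` {..<M}. (1/2) ^ k)" using \<sigma> by (simp add: sum.reindex)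
  also have "\<dots> \<le> (\<Sum>k. (1/2) ^ k)" by (intro sum_le_suminf summable_geometric) auto
  finally show "(\<Sum>k<M. w k * \<bar>(1/2) ^ \<sigma> k\<bar> powr p) \<le> (\<Sum>k. (1/2) ^ k)" .
qed

end

section \<open>Bounded operators\<close>

text \<open>Cesaro means of a null sequence tend to 0: the first \<open>n0\<close> weights
  contribute at most 1 each, the later ones less than \<open>c / 2\<close>.\<close>

lemma sum_weights_sublinear:
  fixes w :: "nat \<Rightarrow> real"
  assumes lim: "w \<longlonglongrightarrow> 0" and w: "\<And>n. w n \<le> 1" and c: "0 < c"
  shows "\<exists>N\<ge>1. (\<Sum>k<N. w k) < c * real N"
proof -
  have "\<forall>\<^sub>F n in sequentially. w n < c / 2" using lim c by (intro order_tendstoD) auto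
  then obtain n0 where n0: "\<And>n. n \<ge> n0 \<Longrightarrow> w n < c / 2" by (auto simp: eventually_sequentially)
  \<comment> \<open>Chosen so that \<open>c / 2 * N\<close> exceeds \<open>n0 + 1\<close>, which
    absorbs the contribution of the first \<open>n0\<close> weights.\<close>
  obtain N :: nat where N: "real N > 2 * (real n0 + 1) / c" using reals_Archimedean2 by blast
  have bound: "(\<Sum>k<m. w k) \<le> real n0 + c / 2 * real m" for m
  proof (induction m)
    case (Suc m)
    show ?case
    proof (cases "m < n0")
      case True
      have "(\<Sum>k<Suc m. w k) \<le> (\<Sum>k<Suc m. 1)" by (intro sum_mono w)
      also have "\<dots> = real (Suc m)" by simp
      also have "\<dots> \<le> real n0 + c / 2 * real (Suc m)"
      proof -
        have "real (Suc m) \<le> real n0" using True by linarith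
        moreover have "0 \<le> c / 2 * real (Suc m)" using c by (intro mult_nonneg_nonneg) auto
        ultimately show ?thesis by linarith
      qed
      finally show ?thesis .
    next
      case False
      then have "w m < c / 2" using n0 by simp
      moreover have "c / 2 * real (Suc m) = c / 2 * real m + c / 2" by (simp add: field_simps)
      ultimately show ?thesis using Suc.IH unfolding sum.lessThan_Suc by linarith
    qed
  qed simp
  have "real n0 + 1 < c / 2 * real N" using N c by (simp add: field_simps)
  then have "(\<Sum>k<N. w k) < c * real N" using bound[of N] by linarith
  moreover have "N \<ge> 1" using N c by (cases N) (auto simp: field_simps)
  ultimately show ?thesis by blast
qed

context lorentz
begin

text \<open>The series of the tail is dominated termwise by that of \<open>x\<close>, so beyond some
  \<open>M\<close>, independent of \<open>L\<close>, its terms are negligible; the first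
  \<open>M\<close> terms are small because the entries of the tail are.\<close>

lemma nrm_tail_seq_tendsto:
  assumes x: "x \<in> lsp"
  shows "(\<lambda>L. nrm (tail_seq L x)) \<longlonglongrightarrow> 0"
proof -
  define a where "a = (\<lambda>n. w n * xstar x n powr p)"
  have xn: "x \<longlonglongrightarrow> 0" using lsp_null[OF x] .
  have tn: "tail_seq L x \<longlonglongrightarrow> 0" for L using lsp_null[OF tail_seq_lsp[OF x]] .
  have sa: "summable a" using x by (simp add: lorentz_space_def a_def)
  have mod: "\<exists>L0. \<forall>L\<ge>L0. modular (tail_seq L x) < r" if r: "0 < r" for r
  proof -
    obtain M where M: "\<bar>\<Sum>n. a (n + M)\<bar> < r / 2"
      using suminf_exist_split[OF half_gt_zero[OF r] sa] by auto
    \<comment> \<open>Then \<open>M\<close> terms of size \<open>s powr p\<close> add up to at most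
      \<open>r / 2\<close>; \<open>Suc M\<close> guards against \<open>M = 0\<close>.\<close>
    define s where "s = (r / (4 * real (Suc M))) powr (1 / p)"
    have s: "0 < s" "s powr p = r / (4 * real (Suc M))"
      using r p_pos by (auto simp: s_def powr_powr)
    obtain L0 where L0: "\<And>k. k \<ge> L0 \<Longrightarrow> \<bar>x k\<bar> < s"
      using LIMSEQ_D[OF xn s(1)] by auto
    have "modular (tail_seq L x) < r" if L: "L \<ge> L0" for L
    proof -
      define b where "b = (\<lambda>n. w n * xstar (tail_seq L x) n powr p)"
      have sb: "summable b" using tail_seq_lsp[OF x] by (simp add: lorentz_space_def b_def)
      have ba: "b n \<le> a n" for n
        unfolding a_def b_def using w_nonneg p_pos xstar_nonneg[OF tn]
        by (intro mult_left_mono powr_mono2 xstar_mono xn tn) (auto simp: tail_seq_def)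
      have bs: "b n \<le> s powr p" for n
      proof -
        have "xstar (tail_seq L x) n \<le> s"
          by (rule xstar_le[OF tn, of "{}"]) (use L L0 s in \<open>auto simp: tail_seq_def less_imp_le\<close>)
        then have "xstar (tail_seq L x) n powr p \<le> s powr p"
          using p_pos xstar_nonneg[OF tn] by (intro powr_mono2) auto
        then have "w n * xstar (tail_seq L x) n powr p \<le> 1 * s powr p"
          using w_nonneg w_le_1 by (intro mult_mono) auto
        then show ?thesis by (simp add: b_def)
      qed
      have "modular (tail_seq L x) = (\<Sum>n. b (n + M)) + (\<Sum>n<M. b n)"
        unfolding modular_def b_def[symmetric] by (rule suminf_split_initial_segment[OF sb])
      also have "\<dots> \<le> (\<Sum>n. a (n + M)) + (\<Sum>n<M. s powr p)"
        using ba bs sa sb by (intro add_mono suminf_le sum_mono) auto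
      also have "\<dots> < r / 2 + r / 2"
      proof (rule add_less_le_mono)
        show "(\<Sum>n. a (n + M)) < r / 2" using M by linarith
        show "(\<Sum>n<M. s powr p) \<le> r / 2" using r by (simp add: s(2) field_simps)
      qed
      finally show ?thesis by simp
    qed
    then show ?thesis by blast
  qed
  show ?thesis
  proof (rule LIMSEQ_I)
    fix e :: real assume e: "0 < e"
    obtain L0 where L0: "\<And>L. L \<ge> L0 \<Longrightarrow> modular (tail_seq L x) < e powr p"
      using mod[of "e powr p"] e by auto
    have "nrm (tail_seq L x) < e" if "L \<ge> L0" for L
    proof -
      have "nrm (tail_seq L x) powr p < e powr p"
        using L0[OF that] modular_eq[OF tail_seq_lsp[OF x]] by simp
      then show ?thesis using p_pos e powr_mono2[of p e] by (meson less_imp_le not_less)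
    qed
    then show "\<exists>no. \<forall>L\<ge>no. norm (nrm (tail_seq L x) - 0) < e"
      using nrm_nonneg by auto
  qed
qed

section \<open>The algebra of bounded operators and their matrices\<close>

abbreviation "ops \<equiv> Lop w p"

lemma ops_lsp: "T \<in> ops \<Longrightarrow> x \<in> lsp \<Longrightarrow> T x \<in> lsp"
  by (simp add: Lop_def)

lemma ops_add: "T \<in> ops \<Longrightarrow> x \<in> lsp \<Longrightarrow> y \<in> lsp \<Longrightarrow> T (vadd x y) = vadd (T x) (T y)"
  by (simp add: Lop_def)

lemma ops_smul: "T \<in> ops \<Longrightarrow> x \<in> lsp \<Longrightarrow> T (vsmul c x) = vsmul c (T x)"
  by (simp add: Lop_def)

lemma ops_outside: "T \<in> ops \<Longrightarrow> x \<notin> lsp \<Longrightarrow> T x = (\<lambda>k. 0)"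
  by (simp add: Lop_def)

lemma ops_zero: "T \<in> ops \<Longrightarrow> T (\<lambda>k. 0) = (\<lambda>k. 0)"
  using ops_smul[OF _ zero_lsp, of T 0] by (simp add: vsmul_def)

text \<open>The constant is normalised to be at least 1 so that it can be divided by.\<close>

lemma ops_bound:
  assumes "T \<in> ops"
  obtains C where "1 \<le> C" "\<And>x. x \<in> lsp \<Longrightarrow> nrm (T x) \<le> C * nrm x"
proof -
  obtain C where C: "\<And>x. x \<in> lsp \<Longrightarrow> nrm (T x) \<le> C * nrm x"
    using assms unfolding Lop_def by blast
  have "nrm (T x) \<le> max 1 C * nrm x" if "x \<in> lsp" for x
    using C[OF that] nrm_nonneg[of x] mult_right_mono[of C "max 1 C" "nrm x"] by linarith
  then show thesis using that[of "max 1 C"] by simp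
qed

lemma opsI:
  assumes "\<And>x. x \<in> lsp \<Longrightarrow> T x \<in> lsp"
    and "\<And>x y. x \<in> lsp \<Longrightarrow> y \<in> lsp \<Longrightarrow> T (vadd x y) = vadd (T x) (T y)"
    and "\<And>c x. x \<in> lsp \<Longrightarrow> T (vsmul c x) = vsmul c (T x)"
    and "\<And>x. x \<in> lsp \<Longrightarrow> nrm (T x) \<le> C * nrm x"
    and "\<And>x. x \<notin> lsp \<Longrightarrow> T x = (\<lambda>k. 0)"
  shows "T \<in> ops"
  using assms unfolding Lop_def by blast

lemma ops_comp:
  assumes S: "S \<in> ops" and T: "T \<in> ops"
  shows "S \<circ> T \<in> ops"
proof -
  obtain C where C: "1 \<le> C" "\<And>x. x \<in> lsp \<Longrightarrow> nrm (S x) \<le> C * nrm x" using ops_bound[OF S] by blast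
  obtain D where D: "1 \<le> D" "\<And>x. x \<in> lsp \<Longrightarrow> nrm (T x) \<le> D * nrm x" using ops_bound[OF T] by blast
  show ?thesis
  proof (rule opsI)
    fix x assume x: "x \<in> lsp"
    have "nrm ((S \<circ> T) x) \<le> C * nrm (T x)" using C ops_lsp[OF T x] by simp
    also have "\<dots> \<le> C * (D * nrm x)" using C D x by (intro mult_left_mono) auto
    finally show "nrm ((S \<circ> T) x) \<le> C * D * nrm x" by simp
  qed (use S T in \<open>auto simp: ops_lsp ops_add ops_smul ops_outside ops_zero\<close>)
qed

lemma ops_opadd:
  assumes S: "S \<in> ops" and T: "T \<in> ops"
  shows "opadd S T \<in> ops"
proof -
  obtain C where C: "1 \<le> C" "\<And>x. x \<in> lsp \<Longrightarrow> nrm (S x) \<le> C * nrm x" using ops_bound[OF S] by blast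
  obtain D where D: "1 \<le> D" "\<And>x. x \<in> lsp \<Longrightarrow> nrm (T x) \<le> D * nrm x" using ops_bound[OF T] by blast
  show ?thesis
  proof (rule opsI)
    fix x assume x: "x \<in> lsp"
    have "nrm (opadd S T x) \<le> 4 * (nrm (S x) + nrm (T x))"
      unfolding opadd_def by (intro lsp_add ops_lsp[OF S x] ops_lsp[OF T x])
    also have "\<dots> \<le> (4 * (C + D)) * nrm x" using C(2)[OF x] D(2)[OF x] by (simp add: algebra_simps)
    finally show "nrm (opadd S T x) \<le> (4 * (C + D)) * nrm x" .
  next
    fix x assume "x \<in> lsp"
    then show "opadd S T x \<in> lsp" unfolding opadd_def by (intro lsp_add ops_lsp[OF S] ops_lsp[OF T])
  next
    fix x y assume "x \<in> lsp" "y \<in> lsp"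
    then show "opadd S T (vadd x y) = vadd (opadd S T x) (opadd S T y)"
      by (simp add: opadd_def ops_add[OF S] ops_add[OF T]) (simp add: vadd_def algebra_simps)
  next
    fix c x assume "x \<in> lsp"
    then show "opadd S T (vsmul c x) = vsmul c (opadd S T x)"
      by (simp add: opadd_def ops_smul[OF S] ops_smul[OF T]) (simp add: vadd_def vsmul_def algebra_simps)
  next
    fix x assume "x \<notin> lsp"
    then show "opadd S T x = (\<lambda>k. 0)" 
      by (simp add: opadd_def ops_outside[OF S] ops_outside[OF T]) (simp add: vadd_def)
  qed
qed

lemma ops_opsmul:
  assumes T: "T \<in> ops"
  shows "opsmul c T \<in> ops"
proof -
  obtain D where D: "1 \<le> D" "\<And>x. x \<in> lsp \<Longrightarrow> nrm (T x) \<le> D * nrm x" using ops_bound[OF T] by blast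
  show ?thesis
  proof (rule opsI)
    fix x assume x: "x \<in> lsp"
    have "nrm (opsmul c T x) \<le> \<bar>c\<bar> * nrm (T x)"
      unfolding opsmul_def by (intro lsp_smul ops_lsp[OF T x])
    also have "\<dots> \<le> \<bar>c\<bar> * (D * nrm x)" using D(2)[OF x] by (intro mult_left_mono) auto
    finally show "nrm (opsmul c T x) \<le> (\<bar>c\<bar> * D) * nrm x" by simp
  next
    fix x assume "x \<in> lsp"
    then show "opsmul c T x \<in> lsp" unfolding opsmul_def by (intro lsp_smul ops_lsp[OF T])
  next
    fix x y assume "x \<in> lsp" "y \<in> lsp"
    then show "opsmul c T (vadd x y) = vadd (opsmul c T x) (opsmul c T y)"
      by (simp add: opsmul_def ops_add[OF T]) (simp add: vadd_def vsmul_def algebra_simps)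
  next
    fix a x assume "x \<in> lsp"
    then show "opsmul c T (vsmul a x) = vsmul a (opsmul c T x)"
      by (simp add: opsmul_def ops_smul[OF T]) (simp add: vsmul_def algebra_simps)
  next
    fix x assume "x \<notin> lsp"
    then show "opsmul c T x = (\<lambda>k. 0)" 
      by (simp add: opsmul_def ops_outside[OF T]) (simp add: vsmul_def)
  qed
qed

lemma opsub_eq: "opsub S T = opadd S (opsmul (-1) T)"
  by (simp add: opsub_def opadd_def opsmul_def vsub_def vadd_def vsmul_def)

lemma ops_opsub: "S \<in> ops \<Longrightarrow> T \<in> ops \<Longrightarrow> opsub S T \<in> ops"
  by (simp add: opsub_eq ops_opadd ops_opsmul)

lemma ops_zero_op: "(\<lambda>x k. 0) \<in> ops"
  by (rule opsI[of _ 0]) (auto simp: zero_lsp nrm_zero vadd_def vsmul_def)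

text \<open>The unit of the algebra. Elements of \<open>ops\<close> vanish outside the space, so the
  plain identity function is not one of them.\<close>

definition id_op :: "(nat \<Rightarrow> real) \<Rightarrow> nat \<Rightarrow> real" where
  "id_op x = (if x \<in> lsp then x else (\<lambda>k. 0))"

lemma id_op_ops: "id_op \<in> ops"
  by (rule opsI[of _ 1]) (auto simp: id_op_def lsp_add lsp_smul)

lemma ops_head_seq:
  assumes T: "T \<in> ops"
  shows "T (head_seq L x) j = (\<Sum>i<L. x i * T (unit_seq i) j)"
proof (induction L)
  case 0 then show ?case using ops_zero[OF T] by (simp add: head_seq_def)
next
  case (Suc L)
  have "head_seq (Suc L) x = vadd (head_seq L x) (vsmul (x L) (unit_seq L))"
    by (intro ext) (auto simp: head_seq_def vadd_def vsmul_def unit_seq_def less_Suc_eq)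
  then have "T (head_seq (Suc L) x) = vadd (T (head_seq L x)) (vsmul (x L) (T (unit_seq L)))"
    by (simp add: ops_add[OF T] ops_smul[OF T] head_seq_lsp lsp_smul unit_seq_lsp)
  then show ?case using Suc by (simp add: vadd_def vsmul_def)
qed

text \<open>Truncations converge in norm, and the norm dominates every coordinate; hence an operator
  acts through its matrix by series converging in each coordinate.\<close>

lemma ops_sums:
  assumes T: "T \<in> ops" and x: "x \<in> lsp"
  shows "(\<lambda>i. x i * T (unit_seq i) j) sums T x j"
proof -
  obtain C where C: "1 \<le> C" "\<And>x. x \<in> lsp \<Longrightarrow> nrm (T x) \<le> C * nrm x" using ops_bound[OF T] by blast
  have "(\<lambda>L. T (tail_seq L x) j) \<longlonglongrightarrow> 0"
  proof (rule Lim_null_comparison)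
    show "(\<lambda>L. C * nrm (tail_seq L x)) \<longlonglongrightarrow> 0"
      using nrm_tail_seq_tendsto[OF x] by (rule tendsto_mult_right_zero)
    have "\<bar>T (tail_seq L x) j\<bar> \<le> C * nrm (tail_seq L x)" for L
      using abs_le_nrm[OF ops_lsp[OF T tail_seq_lsp[OF x]]] C(2)[OF tail_seq_lsp[OF x]]
      by (rule order_trans)
    then show "\<forall>\<^sub>F L in sequentially. norm (T (tail_seq L x) j) \<le> C * nrm (tail_seq L x)" by simp
  qed
  then have "(\<lambda>L. T x j - T (tail_seq L x) j) \<longlonglongrightarrow> T x j"
    using tendsto_diff[OF tendsto_const, of _ 0] by fastforce
  moreover have "T x j - T (tail_seq L x) j = (\<Sum>i<L. x i * T (unit_seq i) j)" for L
  proof -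
    have "T x = vadd (T (head_seq L x)) (T (tail_seq L x))"
      using ops_add[OF T head_seq_lsp tail_seq_lsp[OF x], of L x L] by (simp add: head_add_tail)
    then show ?thesis using ops_head_seq[OF T, of L x j] by (simp add: vadd_def)
  qed
  ultimately show ?thesis by (simp add: sums_def)
qed

text \<open>The sum is at least \<open>w 0 = 1\<close>, so it bounds its own p-th root. This crude
  form is still o(N).\<close>

lemma nrm_finite_support_le:
  assumes F: "finite F" "F \<noteq> {}" and z: "\<And>k. k \<notin> F \<Longrightarrow> z k = 0" "\<And>k. \<bar>z k\<bar> \<le> 1"
  shows "nrm z \<le> (\<Sum>k<card F. w k)"
proof (rule nrm_le)
  show "z \<in> lsp" using finite_support(1)[OF F(1) z(1)] .
  have "card F > 0" using F by (simp add: card_gt_0_iff)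
  then have "w 0 \<le> (\<Sum>k<card F. w k)" using w_nonneg by (intro member_le_sum) auto
  then have 1: "1 \<le> (\<Sum>k<card F. w k)" using w0 by simp
  then show "0 \<le> (\<Sum>k<card F. w k)" by simp
  have "modular z \<le> (\<Sum>k<card F. w k) powr 1" using finite_support(2)[OF F(1) z] 1 by simp
  also have "\<dots> \<le> (\<Sum>k<card F. w k) powr p" using p 1 by (intro powr_mono) auto
  finally show "modular z \<le> (\<Sum>k<card F. w k) powr p" .
qed

text \<open>A signed sum of N unit vectors has norm o(N), so no coordinate of their images
can stay bounded away from 0.\<close>
lemma coordinate_tendsto_0:
  assumes T: "T \<in> ops"
  shows "(\<lambda>n. T (unit_seq n) j) \<longlonglongrightarrow> 0"
proof (rule ccontr)
  assume "\<not> (\<lambda>n. T (unit_seq n) j) \<longlonglongrightarrow> 0"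
  then obtain \<delta> where \<delta>: "0 < \<delta>" "\<And>m. \<exists>n\<ge>m. \<delta> \<le> \<bar>T (unit_seq n) j\<bar>"
    by (auto simp: lim_sequentially not_less)
  have inf: "infinite {n. \<delta> \<le> \<bar>T (unit_seq n) j\<bar>}"
    using \<delta>(2) by (auto simp: infinite_nat_iff_unbounded_le)
  obtain C where C: "1 \<le> C" "\<And>x. x \<in> lsp \<Longrightarrow> nrm (T x) \<le> C * nrm x" using ops_bound[OF T] by blast
  obtain N where N: "1 \<le> N" "(\<Sum>k<N. w k) < \<delta> / C * real N"
    using sum_weights_sublinear[OF wlim w_le_1, of "\<delta> / C"] \<delta> C by auto
  \<comment> \<open>The signs given to these \<open>N\<close> unit vectors by \<open>z\<close> make
    all contributions at coordinate \<open>j\<close> add up without cancellation.\<close>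
  obtain F where F: "F \<subseteq> {n. \<delta> \<le> \<bar>T (unit_seq n) j\<bar>}" "finite F" "card F = N"
    using infinite_arbitrarily_large[OF inf] by blast
  define z where "z k = (if k \<in> F then sgn (T (unit_seq k) j) else 0)" for k
  have z: "z k = 0" if "k \<notin> F" for k using that by (simp add: z_def)
  have zl: "z \<in> lsp" using finite_support(1)[OF F(2) z] .
  obtain L where L: "F \<subseteq> {..<L}" using F finite_nat_iff_bounded by blast
  have "z = head_seq L z"
  proof (rule ext)
    fix k show "z k = head_seq L z k" using L z[of k] by (cases "k \<in> F") (auto simp: head_seq_def)
  qed
  then have "T z j = (\<Sum>i<L. z i * T (unit_seq i) j)" using ops_head_seq[OF T] by metis
  also have "\<dots> = (\<Sum>i\<in>F. z i * T (unit_seq i) j)"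
    using L z by (intro sum.mono_neutral_right) auto
  also have "\<dots> = (\<Sum>i\<in>F. \<bar>T (unit_seq i) j\<bar>)"
    by (intro sum.cong) (auto simp: z_def abs_sgn mult.commute)
  also have "\<dots> \<ge> (\<Sum>i\<in>F. \<delta>)" using F by (intro sum_mono) auto
  finally have "\<delta> * real N \<le> T z j" using F by (simp add: mult.commute)
  also have "\<dots> \<le> nrm (T z)" using abs_le_nrm[OF ops_lsp[OF T zl], of j] by linarith
  also have "\<dots> \<le> C * nrm z" using C zl by simp
  also have "\<dots> \<le> C * (\<Sum>k<N. w k)"
  proof (rule mult_left_mono)
    have "F \<noteq> {}" using F N by auto
    then show "nrm z \<le> (\<Sum>k<N. w k)"
      unfolding F(3)[symmetric] using z by (intro nrm_finite_support_le F) (auto simp: z_def sgn_if)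
  qed (use C in simp)
  also have "\<dots> < \<delta> * real N" using N C by (simp add: field_simps)
  finally show False by simp
qed

end

section \<open>Sup norms of the images of the unit vectors\<close>

lemma powr_midpoint:
  fixes u v :: real
  assumes p: "1 \<le> p" and uv: "0 \<le> u" "0 \<le> v"
  shows "2 * ((u + v) / 2) powr p \<le> u powr p + v powr p"
proof -
  \<comment> \<open>Zero arguments are handled by \<open>2 \<le> 2 powr p\<close>, positive ones by
    midpoint convexity.\<close>
  have zero: "2 * (t / 2) powr p \<le> t powr p" if "0 \<le> t" for t
  proof -
    have "2 powr 1 * (t / 2) powr p \<le> 2 powr p * (t / 2) powr p"
      using p by (intro mult_right_mono powr_mono) auto
    also have "\<dots> = t powr p" using that by (simp add: powr_divide)
    finally show ?thesis by simp
  qed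
  consider "u = 0" | "v = 0" | "0 < u" "0 < v" using uv by linarith
  then show ?thesis
  proof cases
    case 3
    then show ?thesis
      using convex_onD[OF powr_convex[OF p], of "1/2" u v] by (simp add: field_simps)
  qed (use zero[OF uv(1)] zero[OF uv(2)] in simp_all)
qed

text \<open>Averaging over the sign of \<open>b\<close> cannot lower the p-th power of
  \<open>a\<close>: \<open>\<bar>a\<bar>\<close> is at most the mean of
  \<open>\<bar>a + b\<bar>\<close> and \<open>\<bar>a - b\<bar>\<close>, and the power is
  convex.\<close>

lemma powr_parallelogram:
  fixes a b :: real
  assumes p: "1 \<le> p"
  shows "2 * \<bar>a\<bar> powr p \<le> \<bar>a + b\<bar> powr p + \<bar>a - b\<bar> powr p"
proof -
  have "\<bar>a\<bar> powr p \<le> ((\<bar>a + b\<bar> + \<bar>a - b\<bar>) / 2) powr p"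
    using p by (intro powr_mono2) auto
  then show ?thesis using powr_midpoint[OF p, of "\<bar>a + b\<bar>" "\<bar>a - b\<bar>"] by simp
qed

context lorentz
begin

text \<open>A flat vector loses little when few terms are dropped. A finite partial sum exceeds
  \<open>3 / 2 * c\<close>, and the dropped terms cost at most \<open>c / 2\<close>. What remains
  uses weights with index outside \<open>S\<close> and coordinates outside \<open>G\<close>, so it
  can be placed beside an earlier sum.\<close>

lemma modular_away_from_finite:
  assumes u: "u \<in> lsp" and c: "0 < c" "2 * c \<le> modular u"
    and S: "finite S" "finite G" "card G \<le> card S"
    and s: "\<And>k. \<bar>u k\<bar> < s" "2 * real (card S) * s powr p \<le> c / 2"
  obtains S' \<tau> where "finite S'" "S' \<inter> S = {}" "inj \<tau>" "\<tau> ` S' \<inter> G = {}"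
    "c \<le> (\<Sum>k\<in>S'. w k * \<bar>u (\<tau> k)\<bar> powr p)"
proof -
  obtain \<tau> where \<tau>: "inj \<tau>" "\<And>k. xstar u k = \<bar>u (\<tau> k)\<bar>"
    using xstar_enumeration[OF lsp_null[OF u]] by blast
  define f where "f = (\<lambda>k. w k * \<bar>u (\<tau> k)\<bar> powr p)"
  have "f sums modular u"
    using u unfolding modular_def lorentz_space_def f_def \<tau>(2)[symmetric] by (simp add: summable_sums)
  then have "\<forall>\<^sub>F M in sequentially. 3 / 2 * c < (\<Sum>k<M. f k)"
    using c unfolding sums_def by (intro order_tendstoD) auto
  then obtain M where M: "3 / 2 * c < (\<Sum>k<M. f k)" by (auto simp: eventually_sequentially)
  \<comment> \<open>Two reasons to drop an index: its weight is already taken (\<open>S\<close>), or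
    its coordinate is (\<open>G\<close>). Injectivity of \<open>\<tau>\<close> bounds their number
    by \<open>2 * card S\<close>.\<close>
  define bad where "bad = {..<M} \<inter> (S \<union> \<tau> -` G)"
  have "card bad \<le> card (S \<union> \<tau> -` G)"
    unfolding bad_def using S \<tau>(1) by (intro card_mono finite_UnI finite_vimageI) auto
  also have "\<dots> \<le> card S + card (\<tau> -` G)" by (rule card_Un_le)
  also have "card (\<tau> -` G) \<le> card G"
    using S(2) \<tau>(1) by (intro card_inj_on_le[of \<tau>]) (auto intro: inj_on_subset)
  finally have card: "card bad \<le> 2 * card S" using S(3) by linarith
  have "f k \<le> s powr p" for k
  proof -
    have "\<bar>u (\<tau> k)\<bar> powr p \<le> s powr p" using s(1) p_pos by (intro powr_mono2) (auto intro: less_imp_le)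
    then have "f k \<le> 1 * s powr p" unfolding f_def using w_le_1 w_nonneg by (intro mult_mono) auto
    then show ?thesis by simp
  qed
  then have "(\<Sum>k\<in>bad. f k) \<le> real (card bad) * s powr p"
    by (intro sum_bounded_above)
  also have "\<dots> \<le> real (2 * card S) * s powr p"
    using card by (intro mult_right_mono) auto
  finally have bad: "(\<Sum>k\<in>bad. f k) \<le> c / 2" using s(2) by simp
  have "(\<Sum>k\<in>{..<M} - bad. f k) = (\<Sum>k<M. f k) - (\<Sum>k\<in>bad. f k)"
    by (intro sum_diff) (auto simp: bad_def)
  then have "c \<le> (\<Sum>k\<in>{..<M} - bad. f k)" using M bad by linarith
  then show thesis
    using \<tau>(1) by (intro that[of "{..<M} - bad" \<tau>]) (auto simp: bad_def f_def)
qed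

text \<open>The step from N to N + 1 averages over the two signs of the next image vector.\<close>
lemma signed_sum_lower_bound:
  assumes V: "V \<in> ops" and c: "0 < c" and low: "\<And>n. 2 * c \<le> modular (V (unit_seq n))"
    and small: "\<And>\<delta>. 0 < \<delta> \<Longrightarrow> \<exists>m. \<forall>n\<ge>m. \<forall>k. \<bar>V (unit_seq n) k\<bar> < \<delta>"
  shows "\<exists>z F S \<sigma>. finite F \<and> card F = N \<and> (\<forall>k. k \<notin> F \<longrightarrow> z k = 0) \<and> (\<forall>k. \<bar>z k\<bar> \<le> 1) \<and>
    finite S \<and> inj_on \<sigma> S \<and> real N * c \<le> (\<Sum>k\<in>S. w k * \<bar>V z (\<sigma> k)\<bar> powr p)"
proof (induction N)
  case 0
  show ?case by (rule exI[of _ "\<lambda>k. 0"], rule exI[of _ "{}"], rule exI[of _ "{}"]) auto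
next
  case (Suc N)
  then obtain z F S \<sigma> where F: "finite F" "card F = N" and z: "\<And>k. k \<notin> F \<Longrightarrow> z k = 0" "\<And>k. \<bar>z k\<bar> \<le> 1"
    and S: "finite S" "inj_on \<sigma> S" and le: "real N * c \<le> (\<Sum>k\<in>S. w k * \<bar>V z (\<sigma> k)\<bar> powr p)"
    by blast
  have zl: "z \<in> lsp" using finite_support(1)[OF F(1) z(1)] .
  \<comment> \<open>Makes \<open>2 * card S\<close> terms of size \<open>s powr p\<close> cost at
    most \<open>c / 2\<close>.\<close>
  define s where "s = (c / (4 * real (Suc (card S)))) powr (1 / p)"
  have s: "0 < s" "s powr p = c / (4 * real (Suc (card S)))"
    using c p_pos by (auto simp: s_def powr_powr)
  obtain m where m: "\<And>n k. n \<ge> m \<Longrightarrow> \<bar>V (unit_seq n) k\<bar> < s" using small[OF s(1)] by blast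
  obtain L where L: "F \<subseteq> {..<L}" using F finite_nat_iff_bounded by blast
  \<comment> \<open>Beyond \<open>L\<close> the unit vector is new, beyond \<open>m\<close> its
    image is flat.\<close>
  define n where "n = max m L"
  have n: "n \<notin> F" "n \<ge> m" using L by (auto simp: n_def)
  define u where "u = V (unit_seq n)"
  have ul: "u \<in> lsp" unfolding u_def by (rule ops_lsp[OF V unit_seq_lsp])
  obtain S' \<tau> where S': "finite S'" "S' \<inter> S = {}" and \<tau>: "inj \<tau>" "\<tau> ` S' \<inter> \<sigma> ` S = {}"
    and ge: "c \<le> (\<Sum>k\<in>S'. w k * \<bar>u (\<tau> k)\<bar> powr p)"
  proof (rule modular_away_from_finite[OF ul c _ S(1), of "\<sigma> ` S" s])
    show "2 * c \<le> modular u" unfolding u_def by (rule low)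
    show "card (\<sigma> ` S) \<le> card S" using S(1) by (rule card_image_le)
    show "\<bar>u k\<bar> < s" for k unfolding u_def using m n by blast
    show "2 * real (card S) * s powr p \<le> c / 2" using c by (simp add: s(2) field_simps)
  qed (use S in auto)
  define \<rho> where "\<rho> = (\<lambda>k. if k \<in> S then \<sigma> k else \<tau> k)"
  have inj: "inj_on \<rho> (S \<union> S')"
  proof (rule inj_onI)
    fix a b assume ab: "a \<in> S \<union> S'" "b \<in> S \<union> S'" "\<rho> a = \<rho> b"
    show "a = b"
    proof (cases "a \<in> S")
      case True
      then have "b \<in> S" using ab \<tau>(2) by (auto simp: \<rho>_def split: if_splits)
      then show ?thesis using True ab S(2) by (auto simp: \<rho>_def dest: inj_onD)
    next
      case False
      then have "b \<notin> S" using ab \<tau>(2) by (auto simp: \<rho>_def split: if_splits)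
      then show ?thesis using False ab \<tau>(1) by (auto simp: \<rho>_def dest: injD)
    qed
  qed
  define x where "x = V z"
  define g where "g = (\<lambda>y. \<Sum>k\<in>S \<union> S'. w k * \<bar>y (\<rho> k)\<bar> powr p)"
  have split: "g y = (\<Sum>k\<in>S. w k * \<bar>y (\<sigma> k)\<bar> powr p) + (\<Sum>k\<in>S'. w k * \<bar>y (\<tau> k)\<bar> powr p)" for y
  proof -
    have "g y = (\<Sum>k\<in>S. w k * \<bar>y (\<rho> k)\<bar> powr p) + (\<Sum>k\<in>S'. w k * \<bar>y (\<rho> k)\<bar> powr p)"
      unfolding g_def using S S' by (intro sum.union_disjoint) auto
    also have "(\<Sum>k\<in>S. w k * \<bar>y (\<rho> k)\<bar> powr p) = (\<Sum>k\<in>S. w k * \<bar>y (\<sigma> k)\<bar> powr p)"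
      by (intro sum.cong) (auto simp: \<rho>_def)
    also have "(\<Sum>k\<in>S'. w k * \<bar>y (\<rho> k)\<bar> powr p) = (\<Sum>k\<in>S'. w k * \<bar>y (\<tau> k)\<bar> powr p)"
      using S' by (intro sum.cong) (auto simp: \<rho>_def)
    finally show ?thesis .
  qed
  \<comment> \<open>On the old indices the average over signs keeps the part of \<open>x\<close>; on
    the new indices (\<open>pm2\<close>) the roles are exchanged and it keeps the part of
    \<open>u\<close>.\<close>
  have pm1: "2 * (\<Sum>k\<in>S. w k * \<bar>x (\<sigma> k)\<bar> powr p)
      \<le> (\<Sum>k\<in>S. w k * \<bar>vadd x u (\<sigma> k)\<bar> powr p) + (\<Sum>k\<in>S. w k * \<bar>vsub x u (\<sigma> k)\<bar> powr p)"
    unfolding sum_distrib_left sum.distrib[symmetric]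
  proof (rule sum_mono)
    fix k
    have "w k * (2 * \<bar>x (\<sigma> k)\<bar> powr p) \<le> w k * (\<bar>x (\<sigma> k) + u (\<sigma> k)\<bar> powr p + \<bar>x (\<sigma> k) - u (\<sigma> k)\<bar> powr p)"
      using w_nonneg p by (intro mult_left_mono powr_parallelogram)
    then show "2 * (w k * \<bar>x (\<sigma> k)\<bar> powr p) \<le> w k * \<bar>vadd x u (\<sigma> k)\<bar> powr p + w k * \<bar>vsub x u (\<sigma> k)\<bar> powr p"
      by (simp add: vadd_def vsub_def algebra_simps)
  qed
  have pm2: "2 * (\<Sum>k\<in>S'. w k * \<bar>u (\<tau> k)\<bar> powr p)
      \<le> (\<Sum>k\<in>S'. w k * \<bar>vadd x u (\<tau> k)\<bar> powr p) + (\<Sum>k\<in>S'. w k * \<bar>vsub x u (\<tau> k)\<bar> powr p)"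
    unfolding sum_distrib_left sum.distrib[symmetric]
  proof (rule sum_mono)
    fix k
    have "w k * (2 * \<bar>u (\<tau> k)\<bar> powr p) \<le> w k * (\<bar>u (\<tau> k) + x (\<tau> k)\<bar> powr p + \<bar>u (\<tau> k) - x (\<tau> k)\<bar> powr p)"
      using w_nonneg p by (intro mult_left_mono powr_parallelogram)
    then show "2 * (w k * \<bar>u (\<tau> k)\<bar> powr p) \<le> w k * \<bar>vadd x u (\<tau> k)\<bar> powr p + w k * \<bar>vsub x u (\<tau> k)\<bar> powr p"
      by (simp add: vadd_def vsub_def abs_minus_commute algebra_simps)
  qed
  have "2 * (real N * c) + 2 * c \<le> g (vadd x u) + g (vsub x u)"
    using pm1 pm2 le[folded x_def] ge unfolding split by linarith
  \<comment> \<open>The better of the two signs reaches at least the average.\<close>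
  then have "real N * c + c \<le> g (vadd x u) \<or> real N * c + c \<le> g (vsub x u)" by linarith
  moreover have "vadd x u = V (vadd z (vsmul 1 (unit_seq n)))" "vsub x u = V (vadd z (vsmul (-1) (unit_seq n)))"
    unfolding ops_add[OF V zl lsp_smul(1)[OF unit_seq_lsp]] ops_smul[OF V unit_seq_lsp] u_def x_def
    by (simp_all add: vadd_def vsub_def vsmul_def)
  ultimately obtain e :: real where e: "\<bar>e\<bar> = 1" "real N * c + c \<le> g (V (vadd z (vsmul e (unit_seq n))))"
    by (metis abs_1 abs_minus)
  let ?z = "vadd z (vsmul e (unit_seq n))"
  have "\<forall>k. k \<notin> insert n F \<longrightarrow> ?z k = 0" using z(1) by (auto simp: vadd_def vsmul_def unit_seq_def)
  moreover have "\<forall>k. \<bar>?z k\<bar> \<le> 1" using z e(1) n(1) by (auto simp: vadd_def vsmul_def unit_seq_def)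
  moreover have "card (insert n F) = Suc N" using n F by simp
  moreover have "real (Suc N) * c \<le> (\<Sum>k\<in>S \<union> S'. w k * \<bar>V ?z (\<rho> k)\<bar> powr p)"
    using e(2) by (simp add: g_def algebra_simps)
  moreover have "finite (insert n F)" "finite (S \<union> S')" using F(1) S(1) S'(1) by simp_all
  ultimately show ?case using inj by blast
qed

lemma sup_norms_bounded_below:
  assumes V: "V \<in> ops" and a: "0 < a" "\<And>n. a \<le> nrm (V (unit_seq n))"
  shows "\<exists>\<delta>>0. \<forall>m. \<exists>n\<ge>m. \<exists>k. \<delta> \<le> \<bar>V (unit_seq n) k\<bar>"
proof (rule ccontr)
  assume H: "\<not> ?thesis"
  have small: "\<exists>m. \<forall>n\<ge>m. \<forall>k. \<bar>V (unit_seq n) k\<bar> < \<delta>" if "0 < \<delta>" for \<delta>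
    using H that by (meson not_le)
  \<comment> \<open>Half of the lower bound for the p-th powers: the other half pays for the terms
    lost at each step of the construction.\<close>
  define c where "c = a powr p / 2"
  have c: "0 < c" using a by (simp add: c_def)
  have low: "2 * c \<le> modular (V (unit_seq n))" for n
    unfolding modular_eq[OF ops_lsp[OF V unit_seq_lsp]] c_def
    using a p_pos by (simp add: powr_mono2)
  obtain C where C: "1 \<le> C" "\<And>x. x \<in> lsp \<Longrightarrow> nrm (V x) \<le> C * nrm x" using ops_bound[OF V] by blast
  obtain N where N: "1 \<le> N" "(\<Sum>k<N. w k) < c / C powr p * real N"
    using sum_weights_sublinear[OF wlim w_le_1, of "c / C powr p"] c C by auto
  obtain z F S \<sigma> where F: "finite F" "card F = N" and z: "\<And>k. k \<notin> F \<Longrightarrow> z k = 0" "\<And>k. \<bar>z k\<bar> \<le> 1"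
    and S: "finite S" "inj_on \<sigma> S" and le: "real N * c \<le> (\<Sum>k\<in>S. w k * \<bar>V z (\<sigma> k)\<bar> powr p)"
    using signed_sum_lower_bound[OF V c low small, of N] by blast
  have zl: "z \<in> lsp" using finite_support(1)[OF F(1) z(1)] .
  note le
  also have "(\<Sum>k\<in>S. w k * \<bar>V z (\<sigma> k)\<bar> powr p) \<le> modular (V z)"
    by (rule sum_le_modular[OF ops_lsp[OF V zl] S])
  also have "\<dots> \<le> (C * nrm z) powr p"
    unfolding modular_eq[OF ops_lsp[OF V zl]] using C zl p_pos nrm_nonneg by (intro powr_mono2) auto
  also have "\<dots> = C powr p * modular z"
    using C nrm_nonneg by (simp add: powr_mult modular_eq[OF zl])
  also have "\<dots> \<le> C powr p * (\<Sum>k<N. w k)"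
    using finite_support(2)[OF F(1) z] F(2) by (intro mult_left_mono) auto
  also have "\<dots> < C powr p * (c / C powr p * real N)"
    using N C by (intro mult_strict_left_mono) auto
  also have "\<dots> = real N * c" using C by simp
  finally show False by simp
qed

end

section \<open>Factoring the identity\<close>

context lorentz
begin

lemma ops_sub:
  assumes T: "T \<in> ops" and x: "x \<in> lsp" and y: "y \<in> lsp"
  shows "T (vsub x y) = vsub (T x) (T y)"
proof -
  have "vsub x y = vadd x (vsmul (-1) y)" by (simp add: vsub_def vadd_def vsmul_def)
  then show ?thesis
    by (simp add: ops_add[OF T x lsp_smul(1)[OF y]] ops_smul[OF T y]) (simp add: vsub_def vadd_def vsmul_def)
qed

text \<open>Summing the geometric bound over \<open>l\<close> turns 1/8 into 1/4. The factor 1/4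
  makes iterates contract in the sup norm, and the decay in \<open>i\<close> places the image under
  a multiple of the geometric sequence.\<close>

lemma geometric_matrix_bound:
  assumes K: "K \<in> ops" and ent: "\<And>i l. \<bar>K (unit_seq l) i\<bar> \<le> 1 / 8 * (1 / 2) ^ i * (1 / 2) ^ l"
    and x: "x \<in> lsp" "\<And>l. \<bar>x l\<bar> \<le> b"
  shows "\<bar>K x i\<bar> \<le> b * (1 / 4) * (1 / 2) ^ i"
proof -
  let ?g = "\<lambda>l. b * (1 / 8 * (1 / 2) ^ i) * (1 / 2) ^ l"
  have b: "0 \<le> b" using x(2)[of 0] by linarith
  have g: "?g sums (b * (1 / 8 * (1 / 2) ^ i) * (1 / (1 - 1 / 2)))"
    by (intro sums_mult geometric_sums) simp
  have f: "(\<lambda>l. x l * K (unit_seq l) i) sums K x i" by (rule ops_sums[OF K x(1)])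
  have "norm (\<Sum>l. x l * K (unit_seq l) i) \<le> (\<Sum>l. ?g l)"
  proof (rule norm_suminf_le)
    fix l
    have "\<bar>x l\<bar> * \<bar>K (unit_seq l) i\<bar> \<le> b * (1 / 8 * (1 / 2) ^ i * (1 / 2) ^ l)"
      using x(2) ent b by (intro mult_mono) auto
    then show "norm (x l * K (unit_seq l) i) \<le> ?g l" by (simp add: abs_mult mult.assoc)
  qed (use g in \<open>rule sums_summable\<close>)
  then show ?thesis using f g by (simp add: sums_iff)
qed

text \<open>Neumann series, summed coordinatewise.\<close>
lemma left_inverse_near_identity:
  assumes W: "W \<in> ops"
    and ent: "\<And>i l. \<bar>W (unit_seq l) i - unit_seq l i\<bar> \<le> 1 / 8 * (1 / 2) ^ i * (1 / 2) ^ l"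
  obtains R where "R \<in> ops" "\<And>x. x \<in> lsp \<Longrightarrow> R (W x) = x"
proof -
  define K where "K = opsub id_op W"
  have K: "K \<in> ops" unfolding K_def by (intro ops_opsub id_op_ops W)
  have Kx: "K x = vsub x (W x)" if "x \<in> lsp" for x
    using that by (simp add: K_def opsub_def id_op_def)
  have Kent: "\<bar>K (unit_seq l) i\<bar> \<le> 1 / 8 * (1 / 2) ^ i * (1 / 2) ^ l" for i l
    using ent[of l i] by (simp add: Kx[OF unit_seq_lsp] vsub_def abs_minus_commute)
  have Km: "(K ^^ m) x \<in> lsp" if "x \<in> lsp" for m x
    using that by (induction m) (auto intro: ops_lsp[OF K])
  have Kadd: "(K ^^ m) (vadd x y) = vadd ((K ^^ m) x) ((K ^^ m) y)" if "x \<in> lsp" "y \<in> lsp" for m x y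
    using that by (induction m) (auto simp: ops_add[OF K] Km)
  have Ksmul: "(K ^^ m) (vsmul c x) = vsmul c ((K ^^ m) x)" if "x \<in> lsp" for m c x
    using that by (induction m) (auto simp: ops_smul[OF K] Km)
  have bd: "\<bar>(K ^^ m) x i\<bar> \<le> nrm x * (1 / 4) ^ m" if x: "x \<in> lsp" for m x i
  proof (induction m arbitrary: i)
    case 0 then show ?case using abs_le_nrm[OF x] by simp
  next
    case (Suc m)
    have "\<bar>K ((K ^^ m) x) i\<bar> \<le> (nrm x * (1 / 4) ^ m) * (1 / 4) * (1 / 2) ^ i"
      by (rule geometric_matrix_bound[OF K Kent Km[OF x] Suc.IH])
    also have "\<dots> \<le> (nrm x * (1 / 4) ^ m) * (1 / 4) * 1"
      using nrm_nonneg by (intro mult_left_mono) (auto simp: power_le_one)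
    finally show ?case by simp
  qed
  have bdS: "\<bar>(K ^^ Suc m) x i\<bar> \<le> nrm x * (1 / 2) ^ i * (1 / 4) * (1 / 4) ^ m" if x: "x \<in> lsp" for m x i
    using geometric_matrix_bound[OF K Kent Km[OF x] bd[OF x], of m i] by (simp add: algebra_simps)
  define R where "R x = (if x \<in> lsp then (\<lambda>i. \<Sum>m. (K ^^ m) x i) else (\<lambda>k. 0))" for x
  have sm: "summable (\<lambda>m. (K ^^ m) x i)" if x: "x \<in> lsp" for x i
  proof (rule summable_comparison_test)
    show "\<exists>M. \<forall>m\<ge>M. norm ((K ^^ m) x i) \<le> nrm x * (1 / 4) ^ m" using bd[OF x] by auto
    show "summable (\<lambda>m. nrm x * (1 / 4) ^ m)" by (intro summable_mult summable_geometric) simp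
  qed
  have head: "R x i = x i + (\<Sum>m. (K ^^ Suc m) x i)" if x: "x \<in> lsp" for x i
    using suminf_split_head[OF sm[OF x, of i]] x by (simp add: R_def)
  \<comment> \<open>The term \<open>m = 0\<close> is split off because \<open>x\<close> itself has
    no geometric decay; all later terms inherit it from the last application of
    \<open>K\<close>.\<close>
  define y where "y = (\<lambda>x i. \<Sum>m. (K ^^ Suc m) x i)"
  have yle: "\<bar>y x i\<bar> \<le> \<bar>vsmul (nrm x) (\<lambda>k. (1 / 2) ^ k) i\<bar>" if x: "x \<in> lsp" for x i
  proof -
    have g: "(\<lambda>m. nrm x * (1 / 2) ^ i * (1 / 4) * (1 / 4) ^ m) sums (nrm x * (1 / 2) ^ i * (1 / 4) * (1 / (1 - 1 / 4)))"
      by (intro sums_mult geometric_sums) simp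
    have "norm (y x i) \<le> (\<Sum>m. nrm x * (1 / 2) ^ i * (1 / 4) * (1 / 4) ^ m)"
      unfolding y_def using bdS[OF x] g by (intro norm_suminf_le) (auto simp: sums_iff)
    also have "\<dots> = nrm x * (1 / 2) ^ i * (1 / 3)" using g by (simp add: sums_iff)
    also have "\<dots> \<le> nrm x * (1 / 2) ^ i * 1" using nrm_nonneg by (intro mult_left_mono) auto
    finally show ?thesis using nrm_nonneg[of x] by (simp add: vsmul_def abs_mult)
  qed
  have Ry: "R x = vadd x (y x)" if "x \<in> lsp" for x
    using head[OF that] by (auto simp: vadd_def y_def)
  have yl: "y x \<in> lsp" "nrm (y x) \<le> nrm (\<lambda>k. (1 / 2) ^ k) * nrm x" if x: "x \<in> lsp" for x
  proof -
    show "y x \<in> lsp" by (rule lsp_dominated(1)[OF lsp_smul(1)[OF geometric_lsp] yle[OF x]])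
    have "nrm (y x) \<le> nrm (vsmul (nrm x) (\<lambda>k. (1 / 2) ^ k))"
      by (rule lsp_dominated(2)[OF lsp_smul(1)[OF geometric_lsp] yle[OF x]])
    also have "\<dots> \<le> \<bar>nrm x\<bar> * nrm (\<lambda>k. (1 / 2) ^ k)" by (rule lsp_smul(2)[OF geometric_lsp])
    finally show "nrm (y x) \<le> nrm (\<lambda>k. (1 / 2) ^ k) * nrm x"
      using nrm_nonneg[of x] by (simp add: mult.commute)
  qed
  have "R \<in> ops"
  proof (rule opsI)
    fix x assume x: "x \<in> lsp"
    show "R x \<in> lsp" unfolding Ry[OF x] by (rule lsp_add(1)[OF x yl(1)[OF x]])
    have "nrm (R x) \<le> 4 * (nrm x + nrm (y x))" unfolding Ry[OF x] by (rule lsp_add(2)[OF x yl(1)[OF x]])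
    also have "\<dots> \<le> (4 * (1 + nrm (\<lambda>k. (1 / 2) ^ k))) * nrm x" using yl(2)[OF x] by (simp add: algebra_simps)
    finally show "nrm (R x) \<le> (4 * (1 + nrm (\<lambda>k. (1 / 2) ^ k))) * nrm x" .
    fix c show "R (vsmul c x) = vsmul c (R x)"
      using x suminf_mult[OF sm[OF x], of c] by (simp add: R_def lsp_smul Ksmul) (simp add: vsmul_def)
  next
    fix x z assume x: "x \<in> lsp" and z: "z \<in> lsp"
    then show "R (vadd x z) = vadd (R x) (R z)"
      using suminf_add[OF sm[OF x] sm[OF z]] by (simp add: R_def lsp_add Kadd) (simp add: vadd_def)
  qed (simp add: R_def)
  moreover have "R (W x) = x" if x: "x \<in> lsp" for x
  proof
    fix i
    \<comment> \<open>Telescoping: the series for \<open>R (K x)\<close> is the series for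
      \<open>R x\<close> without its first term \<open>x\<close>.\<close>
    have "W x = vsub x (K x)" unfolding Kx[OF x] by (simp add: vsub_def)
    then have "R (W x) = vsub (R x) (R (K x))"
      by (simp add: ops_sub[OF \<open>R \<in> ops\<close> x ops_lsp[OF K x]])
    then show "R (W x) i = x i"
      using head[OF x, of i] ops_lsp[OF K x] by (simp add: vsub_def R_def funpow_swap1)
  qed
  ultimately show thesis using that by blast
qed

text \<open>A gliding hump: row and column are chosen together, each new pair so late that its
  entries against all earlier pairs are negligible.\<close>

lemma sparse_submatrix:
  fixes a :: "nat \<Rightarrow> nat \<Rightarrow> real" and e :: "nat \<Rightarrow> real"
  assumes rows: "\<And>n. a n \<longlonglongrightarrow> 0" and cols: "\<And>j. (\<lambda>n. a n j) \<longlonglongrightarrow> 0"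
    and \<delta>: "0 < \<delta>" "\<And>m. \<exists>n\<ge>m. \<exists>j. \<delta> \<le> \<bar>a n j\<bar>" and e: "\<And>l. 0 < e l"
  obtains f g where "strict_mono f" "strict_mono g" "\<And>l. \<delta> \<le> \<bar>a (f l) (g l)\<bar>"
    "\<And>i l. i < l \<Longrightarrow> \<bar>a (f l) (g i)\<bar> \<le> e l" "\<And>i l. i < l \<Longrightarrow> \<bar>a (f i) (g l)\<bar> \<le> e l"
proof -
  define P where "P h l r \<longleftrightarrow> \<delta> \<le> \<bar>a (fst r) (snd r)\<bar> \<and> (\<forall>i<l. fst (h i) < fst r \<and> snd (h i) < snd r \<and>
     \<bar>a (fst r) (snd (h i))\<bar> \<le> e l \<and> \<bar>a (fst (h i)) (snd r)\<bar> \<le> e l)"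
    for h :: "nat \<Rightarrow> nat \<times> nat" and l :: nat and r :: "nat \<times> nat"
  have "\<exists>h. \<forall>l. P h l (h l)"
  proof (rule dependent_wellorder_choice)
    fix r :: "nat \<times> nat" and h h' :: "nat \<Rightarrow> nat \<times> nat" and l :: nat
    assume "\<And>i. i < l \<Longrightarrow> h i = h' i"
    then show "P h l r = P h' l r" by (simp add: P_def)
  next
    fix l :: nat and h :: "nat \<Rightarrow> nat \<times> nat"
    have small: "\<forall>\<^sub>F j in sequentially. \<bar>b j\<bar> < t" if "b \<longlonglongrightarrow> 0" "0 < t" for b :: "nat \<Rightarrow> real" and t
      using order_tendstoD(2)[OF tendsto_rabs_zero[OF that(1)] that(2)] .
    have "\<forall>\<^sub>F j in sequentially. \<forall>i\<in>{..<l}. \<bar>a (fst (h i)) j\<bar> < e l \<and> snd (h i) < j"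
      by (intro eventually_ball_finite ballI eventually_conj small rows e eventually_gt_at_top) auto
    then obtain J where J: "\<And>j. j \<ge> J \<Longrightarrow> \<forall>i\<in>{..<l}. \<bar>a (fst (h i)) j\<bar> < e l \<and> snd (h i) < j"
      by (auto simp: eventually_sequentially)
    \<comment> \<open>The row is taken so late that its first \<open>J\<close> entries are below
      \<open>\<delta>\<close>. This forces its large entry into a column from \<open>J\<close> on,
      where the earlier rows are already small.\<close>
    have "\<forall>\<^sub>F n in sequentially. (\<forall>i\<in>{..<l}. \<bar>a n (snd (h i))\<bar> < e l \<and> fst (h i) < n)
        \<and> (\<forall>j\<in>{..<J}. \<bar>a n j\<bar> < \<delta>)"
      by (intro eventually_ball_finite ballI eventually_conj small cols e \<delta>(1) eventually_gt_at_top) auto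
    then obtain m where m: "\<And>n. n \<ge> m \<Longrightarrow> (\<forall>i\<in>{..<l}. \<bar>a n (snd (h i))\<bar> < e l \<and> fst (h i) < n)
        \<and> (\<forall>j\<in>{..<J}. \<bar>a n j\<bar> < \<delta>)"
      by (auto simp: eventually_sequentially)
    obtain n j where nj: "n \<ge> m" "\<delta> \<le> \<bar>a n j\<bar>" using \<delta>(2) by blast
    have "j \<ge> J"
    proof (rule ccontr)
      assume "\<not> j \<ge> J"
      then have "\<bar>a n j\<bar> < \<delta>" using m[OF nj(1)] by auto
      then show False using nj by simp
    qed
    then have "P h l (n, j)" using m[OF nj(1)] J nj(2) by (auto simp: P_def less_imp_le)
    then show "\<exists>r. P h l r" by blast
  qed
  then obtain h where h: "\<And>l. P h l (h l)" by blast
  show thesis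
  proof (rule that[of "\<lambda>l. fst (h l)" "\<lambda>l. snd (h l)"])
    show "strict_mono (\<lambda>l. fst (h l))" "strict_mono (\<lambda>l. snd (h l))"
      using h by (auto intro!: strict_monoI simp: P_def)
  qed (use h in \<open>auto simp: P_def\<close>)
qed

lemma factor_identity:
  assumes V: "V \<in> ops" and \<delta>: "0 < \<delta>" "\<And>m. \<exists>n\<ge>m. \<exists>k. \<delta> \<le> \<bar>V (unit_seq n) k\<bar>"
  obtains A B where "A \<in> ops" "B \<in> ops" "\<And>x. x \<in> lsp \<Longrightarrow> A (V (B x)) = x"
proof -
  \<comment> \<open>After division by a diagonal entry of size at least \<open>\<delta>\<close>, the
    tolerance becomes \<open>1 / 8 * (1 / 4) ^ m\<close> with \<open>m\<close> the larger index, and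
    \<open>(1 / 4) ^ m\<close> is at most \<open>(1 / 2) ^ i * (1 / 2) ^ l\<close>.\<close>
  obtain f g where fg: "strict_mono f" "strict_mono g" and diag: "\<And>l. \<delta> \<le> \<bar>V (unit_seq (f l)) (g l)\<bar>"
    and below: "\<And>i l. i < l \<Longrightarrow> \<bar>V (unit_seq (f l)) (g i)\<bar> \<le> \<delta> / 8 * (1 / 4) ^ l"
    and above: "\<And>i l. i < l \<Longrightarrow> \<bar>V (unit_seq (f i)) (g l)\<bar> \<le> \<delta> / 8 * (1 / 4) ^ l"
  proof (rule sparse_submatrix[of "\<lambda>n. V (unit_seq n)" \<delta> "\<lambda>l. \<delta> / 8 * (1 / 4) ^ l"])
    show "V (unit_seq n) \<longlonglongrightarrow> 0" for n by (rule lsp_null[OF ops_lsp[OF V unit_seq_lsp]])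
    show "(\<lambda>n. V (unit_seq n) j) \<longlonglongrightarrow> 0" for j by (rule coordinate_tendsto_0[OF V])
  qed (use \<delta> in auto)
  define d where "d = (\<lambda>i. V (unit_seq (f i)) (g i))"
  have d: "\<delta> \<le> \<bar>d i\<bar>" for i using diag by (simp add: d_def)
  have d0: "d i \<noteq> 0" for i using d[of i] \<delta>(1) by auto
  \<comment> \<open>\<open>B\<close> moves the unit vector \<open>l\<close> to position
    \<open>f l\<close>; \<open>A\<close> reads the coordinates \<open>g i\<close> and normalises the
    diagonal, so that \<open>A \<circ> V \<circ> B\<close> has ones there.\<close>
  define B where "B x = (if x \<in> lsp then (\<lambda>k. if k \<in> range f then x (inv f k) else 0) else (\<lambda>k. 0))" for x
  define A where "A x = (if x \<in> lsp then (\<lambda>i. x (g i) / d i) else (\<lambda>k. 0))" for x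
  have B: "B \<in> ops"
  proof (rule opsI[of _ 1])
    fix x assume x: "x \<in> lsp"
    show "B x \<in> lsp" "nrm (B x) \<le> 1 * nrm x" using lsp_spread[OF x fg(1)] x by (simp_all add: B_def)
  qed (auto simp: B_def lsp_add lsp_smul, auto simp: vadd_def vsmul_def)
  have Adom: "(\<lambda>i. x (g i) / d i) \<in> lsp \<and> nrm (\<lambda>i. x (g i) / d i) \<le> 1 / \<delta> * nrm x" if x: "x \<in> lsp" for x
  proof -
    let ?y = "vsmul (1 / \<delta>) (\<lambda>i. x (g i))"
    have le: "\<bar>x (g i) / d i\<bar> \<le> \<bar>?y i\<bar>" for i
      using d[of i] \<delta>(1) by (simp add: vsmul_def abs_mult divide_left_mono)
    have y: "?y \<in> lsp" by (rule lsp_smul(1)[OF lsp_reindex(1)[OF x fg(2)]])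
    have "nrm ?y \<le> \<bar>1 / \<delta>\<bar> * nrm (\<lambda>i. x (g i))" by (rule lsp_smul(2)[OF lsp_reindex(1)[OF x fg(2)]])
    also have "\<dots> \<le> \<bar>1 / \<delta>\<bar> * nrm x" by (intro mult_left_mono lsp_reindex(2)[OF x fg(2)]) simp
    also have "\<dots> = 1 / \<delta> * nrm x" using \<delta>(1) by simp
    finally show ?thesis using lsp_dominated[OF y le] by auto
  qed
  have A: "A \<in> ops"
  proof (rule opsI[of _ "1 / \<delta>"])
    fix x assume x: "x \<in> lsp"
    show "A x \<in> lsp" "nrm (A x) \<le> 1 / \<delta> * nrm x" using Adom[OF x] x by (simp_all add: A_def)
  qed (auto simp: A_def lsp_add lsp_smul, auto simp: vadd_def vsmul_def add_divide_distrib)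
  have Bunit: "B (unit_seq l) = unit_seq (f l)" for l
  proof
    fix k
    have inj: "inj f" using strict_mono_imp_inj_on[OF fg(1)] .
    show "B (unit_seq l) k = unit_seq (f l) k"
    proof (cases "k \<in> range f")
      case True
      then obtain i where "k = f i" by blast
      then show ?thesis using inj by (simp add: B_def unit_seq_lsp) (simp add: unit_seq_def inj_eq)
    next
      case False
      then show ?thesis by (auto simp: B_def unit_seq_def)
    qed
  qed
  define W where "W = A \<circ> (V \<circ> B)"
  have W: "W \<in> ops" unfolding W_def by (intro ops_comp A V B)
  have Wunit: "W (unit_seq l) i = V (unit_seq (f l)) (g i) / d i" for l i
    by (simp add: W_def Bunit A_def ops_lsp[OF V unit_seq_lsp])
  have quarter: "\<bar>t / d i\<bar> \<le> 1 / 8 * (1 / 4) ^ m" if "\<bar>t\<bar> \<le> \<delta> / 8 * (1 / 4) ^ m" for t i m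
  proof -
    have "\<bar>t / d i\<bar> \<le> \<bar>t\<bar> / \<delta>" using d[of i] \<delta>(1) by (simp add: divide_left_mono)
    also have "\<dots> \<le> (\<delta> / 8 * (1 / 4) ^ m) / \<delta>" using that \<delta>(1) by (intro divide_right_mono) auto
    finally show ?thesis using \<delta>(1) by simp
  qed
  have pow: "(1 / 4) ^ m \<le> (1 / 2) ^ i * ((1 / 2) ^ l :: real)" if "i \<le> m" "l \<le> m" for i l m :: nat
  proof -
    have "(1 / 4 :: real) ^ m = (1 / 2) ^ m * (1 / 2) ^ m" by (simp add: power_mult_distrib[symmetric])
    also have "\<dots> \<le> (1 / 2) ^ i * (1 / 2) ^ l" using that by (intro mult_mono power_decreasing) auto
    finally show ?thesis .
  qed
  have "\<bar>W (unit_seq l) i - unit_seq l i\<bar> \<le> 1 / 8 * (1 / 2) ^ i * (1 / 2) ^ l" for i l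
  proof (cases i l rule: linorder_cases)
    case equal
    then have "W (unit_seq l) i = unit_seq l i"
      using d0[of i] by (simp add: Wunit d_def) (simp add: unit_seq_def)
    then show ?thesis by simp
  next
    case less
    then have "\<bar>W (unit_seq l) i\<bar> \<le> 1 / 8 * (1 / 4) ^ l" unfolding Wunit by (intro quarter below)
    also have "\<dots> \<le> 1 / 8 * ((1 / 2) ^ i * (1 / 2) ^ l)" using less by (intro mult_left_mono pow) auto
    finally show ?thesis using less by (simp add: unit_seq_def)
  next
    case greater
    then have "\<bar>W (unit_seq l) i\<bar> \<le> 1 / 8 * (1 / 4) ^ i" unfolding Wunit by (intro quarter above)
    also have "\<dots> \<le> 1 / 8 * ((1 / 2) ^ i * (1 / 2) ^ l)" using greater by (intro mult_left_mono pow) auto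
    finally show ?thesis using greater by (simp add: unit_seq_def)
  qed
  then obtain R where R: "R \<in> ops" "\<And>x. x \<in> lsp \<Longrightarrow> R (W x) = x"
    using left_inverse_near_identity[OF W] by blast
  show thesis
    by (rule that[of "R \<circ> A" B]) (use R B A in \<open>auto simp: W_def intro: ops_comp\<close>)
qed

end

section \<open>The ideal of strictly singular operators\<close>

context lorentz
begin

text \<open>The range of \<open>B\<close> is a copy of the space on which \<open>T\<close> is
  bounded below. It is closed because \<open>B \<circ> A \<circ> T\<close> is a bounded projection
  onto it, so it consists of the fixed points of that projection.\<close>

lemma factor_identity_not_SS:
  assumes A: "A \<in> ops" and B: "B \<in> ops" and T: "T \<in> ops"
    and id: "\<And>x. x \<in> lsp \<Longrightarrow> A (T (B x)) = x"
  shows "T \<notin> SS w p"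
proof
  assume SS: "T \<in> SS w p"
  obtain a where a: "1 \<le> a" "\<And>x. x \<in> lsp \<Longrightarrow> nrm (A x) \<le> a * nrm x" using ops_bound[OF A] by blast
  obtain b where b: "1 \<le> b" "\<And>x. x \<in> lsp \<Longrightarrow> nrm (B x) \<le> b * nrm x" using ops_bound[OF B] by blast
  obtain t where t: "1 \<le> t" "\<And>x. x \<in> lsp \<Longrightarrow> nrm (T x) \<le> t * nrm x" using ops_bound[OF T] by blast
  have low: "nrm x \<le> a * nrm (T (B x))" if "x \<in> lsp" for x
    using a(2)[OF ops_lsp[OF T ops_lsp[OF B that]]] id[OF that] by simp
  define Z where "Z = B ` lsp"
  have Zlsp: "Z \<subseteq> lsp" using ops_lsp[OF B] by (auto simp: Z_def)
  have "closed_subspace w p Z"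
    unfolding closed_subspace_def
  proof (intro conjI ballI allI impI)
    show "Z \<subseteq> lsp" by (rule Zlsp)
    show "(\<lambda>k. 0) \<in> Z" using ops_zero[OF B] zero_lsp unfolding Z_def by (metis image_eqI)
    show "vadd x y \<in> Z" if "x \<in> Z" "y \<in> Z" for x y
      using that ops_add[OF B] lsp_add(1) unfolding Z_def by (smt (verit) image_iff)
    show "vsmul c x \<in> Z" if "x \<in> Z" for c x
      using that ops_smul[OF B] lsp_smul(1) unfolding Z_def by (smt (verit) image_iff)
    fix X z assume X: "\<forall>n. X n \<in> Z" and z: "z \<in> lsp"
      and lim: "(\<lambda>n. nrm (vsub (X n) z)) \<longlonglongrightarrow> 0"
    have Xl: "X n \<in> lsp" for n using X Zlsp by blast
    define Q where "Q = B \<circ> (A \<circ> T)"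
    have Q: "Q \<in> ops" unfolding Q_def by (intro ops_comp A B T)
    obtain q where q: "1 \<le> q" "\<And>x. x \<in> lsp \<Longrightarrow> nrm (Q x) \<le> q * nrm x" using ops_bound[OF Q] by blast
    have QX: "Q (X n) = X n" for n
    proof -
      obtain y where "y \<in> lsp" "X n = B y" using X by (auto simp: Z_def)
      then show ?thesis by (simp add: Q_def id)
    qed
    have "z k = Q z k" for k
    proof (rule LIMSEQ_unique)
      have l1: "(\<lambda>n. X n k - z k) \<longlonglongrightarrow> 0"
      proof (rule Lim_null_comparison[OF _ lim])
        show "\<forall>\<^sub>F n in sequentially. norm (X n k - z k) \<le> nrm (vsub (X n) z)"
          using abs_le_nrm[OF lsp_sub(1)[OF Xl z], of _ k] by (simp add: vsub_def)
      qed
      then show "(\<lambda>n. X n k) \<longlonglongrightarrow> z k" by (simp add: LIM_zero_iff)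
      have l2: "(\<lambda>n. X n k - Q z k) \<longlonglongrightarrow> 0"
      proof (rule Lim_null_comparison[OF _ tendsto_mult_right_zero[OF lim]])
        have "\<bar>vsub (X n) (Q z) k\<bar> \<le> q * nrm (vsub (X n) z)" for n
        proof -
          have "vsub (X n) (Q z) = Q (vsub (X n) z)" using ops_sub[OF Q Xl z] QX by simp
          then show ?thesis
            using abs_le_nrm[OF ops_lsp[OF Q lsp_sub(1)[OF Xl z]], of n k] q(2)[OF lsp_sub(1)[OF Xl z], of n]
            by simp
        qed
        then show "\<forall>\<^sub>F n in sequentially. norm (X n k - Q z k) \<le> q * nrm (vsub (X n) z)"
          by (simp add: vsub_def)
      qed
      then show "(\<lambda>n. X n k) \<longlonglongrightarrow> Q z k" by (simp add: LIM_zero_iff)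
    qed
    then have "z = Q z" by blast
    then show "z \<in> Z" using ops_lsp[OF A ops_lsp[OF T z]] unfolding Q_def Z_def by (metis comp_apply image_eqI)
  qed
  moreover have "iso_to_space w p Z"
    unfolding iso_to_space_def
  proof (intro exI[of _ B] conjI)
    have "1 / (a * t) * nrm x \<le> nrm (B x)" if x: "x \<in> lsp" for x
    proof -
      have "nrm x \<le> a * (t * nrm (B x))"
        using order_trans[OF low[OF x] mult_left_mono[OF t(2)[OF ops_lsp[OF B x]]]] a by simp
      then show ?thesis using a t by (simp add: field_simps)
    qed
    moreover have "0 < 1 / (a * t)" "0 < b" using a b t by auto
    ultimately show "\<exists>a b. 0 < a \<and> 0 < b \<and> (\<forall>x\<in>lsp. a * nrm x \<le> nrm (B x) \<and> nrm (B x) \<le> b * nrm x)"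
      using b(2) by blast
  qed (auto simp: Z_def ops_add[OF B] ops_smul[OF B])
  moreover have "iso_on w p T Z"
    unfolding iso_on_def
  proof (intro exI[of _ "1 / (a * b)"] conjI ballI)
    fix z assume "z \<in> Z"
    then obtain x where x: "x \<in> lsp" "z = B x" by (auto simp: Z_def)
    have "nrm z \<le> b * (a * nrm (T z))"
      unfolding x(2) using order_trans[OF b(2)[OF x(1)] mult_left_mono[OF low[OF x(1)]]] b by simp
    then show "1 / (a * b) * nrm z \<le> nrm (T z)" using a b by (simp add: field_simps)
  qed (use a b in simp)
  ultimately show False using SS by (auto simp: SS_def)
qed

text \<open>Testing all \<open>U\<close> at once builds stability under right composition into the
  notion; uniformity in \<open>k\<close> is smallness of the sup norm.\<close>

definition vanishing :: "((nat \<Rightarrow> real) \<Rightarrow> nat \<Rightarrow> real) \<Rightarrow> bool" where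
  "vanishing T \<longleftrightarrow> (\<forall>U\<in>ops. \<forall>\<delta>>0. \<exists>m. \<forall>n\<ge>m. \<forall>k. \<bar>T (U (unit_seq n)) k\<bar> < \<delta>)"

lemma not_vanishing_factor:
  assumes T: "T \<in> ops" and nv: "\<not> vanishing T"
  obtains A B where "A \<in> ops" "B \<in> ops" "\<And>x. x \<in> lsp \<Longrightarrow> A (T (B x)) = x"
proof -
  obtain U \<delta> where U: "U \<in> ops" and \<delta>: "0 < \<delta>" "\<And>m. \<exists>n\<ge>m. \<exists>k. \<delta> \<le> \<bar>T (U (unit_seq n)) k\<bar>"
    using nv unfolding vanishing_def by (meson not_le)
  have V: "T \<circ> U \<in> ops" by (rule ops_comp[OF T U])
  obtain A B where AB: "A \<in> ops" "B \<in> ops" "\<And>x. x \<in> lsp \<Longrightarrow> A ((T \<circ> U) (B x)) = x"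
    using factor_identity[OF V \<delta>(1)] \<delta>(2) by auto
  show thesis using that[of A "U \<circ> B"] AB ops_comp[OF U AB(2)] by simp
qed

text \<open>The isomorphism onto a copy fixed by \<open>T\<close> serves as the \<open>U\<close> of
  the criterion: composed with \<open>T\<close> it keeps the norms of the images of the unit vectors
  bounded below, hence their sup norms cannot tend to 0.\<close>

lemma not_SS_not_vanishing:
  assumes T: "T \<in> ops" and nss: "T \<notin> SS w p"
  shows "\<not> vanishing T"
proof
  assume van: "vanishing T"
  obtain Z where Z: "closed_subspace w p Z" "iso_to_space w p Z" "iso_on w p T Z"
    using T nss by (auto simp: SS_def)
  obtain U a b where UZ: "U ` lsp = Z" and Uadd: "\<And>x y. x \<in> lsp \<Longrightarrow> y \<in> lsp \<Longrightarrow> U (vadd x y) = vadd (U x) (U y)"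
    and Usm: "\<And>c x. x \<in> lsp \<Longrightarrow> U (vsmul c x) = vsmul c (U x)" and a: "0 < a"
    and Ubd: "\<And>x. x \<in> lsp \<Longrightarrow> a * nrm x \<le> nrm (U x)" "\<And>x. x \<in> lsp \<Longrightarrow> nrm (U x) \<le> b * nrm x"
    using Z(2) unfolding iso_to_space_def by blast
  obtain c where c: "0 < c" "\<And>z. z \<in> Z \<Longrightarrow> c * nrm z \<le> nrm (T z)"
    using Z(3) unfolding iso_on_def by blast
  have Ulsp: "U x \<in> lsp" if "x \<in> lsp" for x
    using that UZ Z(1) unfolding closed_subspace_def by blast
  \<comment> \<open>The isomorphism is arbitrary outside the space; it is reset to 0 there to become
    an element of \<open>ops\<close>.\<close>
  define U' where "U' x = (if x \<in> lsp then U x else (\<lambda>k. 0))" for x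
  have U': "U' \<in> ops"
    by (rule opsI[of _ b]) (auto simp: U'_def Ulsp Uadd Usm Ubd lsp_add lsp_smul)
  have V: "T \<circ> U' \<in> ops" by (rule ops_comp[OF T U'])
  have "c * a \<le> nrm ((T \<circ> U') (unit_seq n))" for n
  proof -
    have "a \<le> nrm (U (unit_seq n))" using Ubd(1)[OF unit_seq_lsp, of n] by (simp add: nrm_unit_seq)
    then have "c * a \<le> c * nrm (U (unit_seq n))" using c(1) by (intro mult_left_mono) auto
    also have "\<dots> \<le> nrm (T (U (unit_seq n)))" using UZ unit_seq_lsp by (intro c(2)) blast
    finally show ?thesis by (simp add: U'_def unit_seq_lsp)
  qed
  then obtain \<delta> where "0 < \<delta>" "\<And>m. \<exists>n\<ge>m. \<exists>k. \<delta> \<le> \<bar>(T \<circ> U') (unit_seq n) k\<bar>"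
    using sup_norms_bounded_below[OF V, of "c * a"] a c by auto
  then show False using van U' unfolding vanishing_def by (metis comp_apply not_le)
qed

text \<open>A circle of implications: a failure of \<open>vanishing\<close> factors the identity, a
  factorization gives a fixed copy, and a fixed copy makes \<open>vanishing\<close> fail.\<close>

lemma SS_iff: "T \<in> SS w p \<longleftrightarrow> T \<in> ops \<and> vanishing T"
proof
  assume T: "T \<in> SS w p"
  then have "T \<in> ops" by (simp add: SS_def)
  then show "T \<in> ops \<and> vanishing T"
    using T not_vanishing_factor factor_identity_not_SS by metis
next
  assume "T \<in> ops \<and> vanishing T"
  then show "T \<in> SS w p" using not_SS_not_vanishing by blast
qed

lemma abs_le_opnorm:
  assumes T: "T \<in> ops" and x: "x \<in> lsp" "nrm x \<le> 1"
  shows "\<bar>T x k\<bar> \<le> opnorm w p T"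
proof -
  obtain C where C: "1 \<le> C" "\<And>x. x \<in> lsp \<Longrightarrow> nrm (T x) \<le> C * nrm x" using ops_bound[OF T] by blast
  have "nrm (T x) \<le> opnorm w p T"
    unfolding opnorm_def
  proof (rule cSup_upper)
    show "bdd_above {nrm (T x) |x. x \<in> lsp \<and> nrm x \<le> 1}"
    proof (rule bdd_aboveI[of _ C])
      fix r assume "r \<in> {nrm (T x) |x. x \<in> lsp \<and> nrm x \<le> 1}"
      then obtain y where y: "y \<in> lsp" "nrm y \<le> 1" "r = nrm (T y)" by blast
      have "nrm (T y) \<le> C * nrm y" by (rule C(2)[OF y(1)])
      also have "\<dots> \<le> C * 1" using C y by (intro mult_left_mono) auto
      finally show "r \<le> C" using y by simp
    qed
  qed (use x in blast)
  then show ?thesis using abs_le_nrm[OF ops_lsp[OF T x(1)], of k] by linarith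
qed

section \<open>Ideal property, maximality and norm closedness\<close>

lemma is_ideal_SS: "is_ideal w p (SS w p)"
  unfolding is_ideal_def
proof (intro conjI ballI allI)
  show "SS w p \<subseteq> ops" by (auto simp: SS_iff)
  have "vanishing (\<lambda>x k. 0)" by (auto simp: vanishing_def)
  then show "(\<lambda>x k. 0) \<in> SS w p" by (simp add: SS_iff ops_zero_op)
next
  fix S T assume S: "S \<in> SS w p" and T: "T \<in> SS w p"
  have "vanishing (opadd S T)"
    unfolding vanishing_def
  proof (intro ballI allI impI)
    fix U and \<delta> :: real assume U: "U \<in> ops" and \<delta>: "0 < \<delta>"
    obtain m where m: "\<And>n k. n \<ge> m \<Longrightarrow> \<bar>S (U (unit_seq n)) k\<bar> < \<delta> / 2"
      using S U half_gt_zero[OF \<delta>] unfolding SS_iff vanishing_def by blast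
    obtain m' where m': "\<And>n k. n \<ge> m' \<Longrightarrow> \<bar>T (U (unit_seq n)) k\<bar> < \<delta> / 2"
      using T U half_gt_zero[OF \<delta>] unfolding SS_iff vanishing_def by blast
    have "\<bar>opadd S T (U (unit_seq n)) k\<bar> < \<delta>" if "n \<ge> max m m'" for n k
      using m[of n k] m'[of n k] that by (simp add: opadd_def vadd_def)
    then show "\<exists>m. \<forall>n\<ge>m. \<forall>k. \<bar>opadd S T (U (unit_seq n)) k\<bar> < \<delta>" by blast
  qed
  then show "opadd S T \<in> SS w p" using S T by (simp add: SS_iff ops_opadd)
next
  fix c T assume T: "T \<in> SS w p"
  have "vanishing (opsmul c T)"
    unfolding vanishing_def
  proof (intro ballI allI impI)
    fix U and \<delta> :: real assume U: "U \<in> ops" and \<delta>: "0 < \<delta>"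
    have "0 < \<delta> / (\<bar>c\<bar> + 1)" using \<delta> by simp
    then obtain m where m: "\<And>n k. n \<ge> m \<Longrightarrow> \<bar>T (U (unit_seq n)) k\<bar> < \<delta> / (\<bar>c\<bar> + 1)"
      using T U unfolding SS_iff vanishing_def by blast
    have "\<bar>opsmul c T (U (unit_seq n)) k\<bar> < \<delta>" if "n \<ge> m" for n k
    proof -
      have "\<bar>c * T (U (unit_seq n)) k\<bar> \<le> (\<bar>c\<bar> + 1) * \<bar>T (U (unit_seq n)) k\<bar>"
        by (simp add: abs_mult mult_right_mono)
      also have "\<dots> < (\<bar>c\<bar> + 1) * (\<delta> / (\<bar>c\<bar> + 1))"
        using m[OF that] by (intro mult_strict_left_mono) auto
      also have "\<dots> = \<delta>" by (simp add: field_simps)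
      finally show ?thesis by (simp add: opsmul_def vsmul_def)
    qed
    then show "\<exists>m. \<forall>n\<ge>m. \<forall>k. \<bar>opsmul c T (U (unit_seq n)) k\<bar> < \<delta>" by blast
  qed
  then show "opsmul c T \<in> SS w p" using T by (simp add: SS_iff ops_opsmul)
next
  fix S A assume S: "S \<in> SS w p" and A: "A \<in> ops"
  have So: "S \<in> ops" using S by (simp add: SS_iff)
  \<comment> \<open>\<open>A\<close> need not be bounded for the sup norm, so the criterion does not
    pass through it directly. A factorization of the identity through \<open>A \<circ> S\<close> is
    one through \<open>S\<close>.\<close>
  show "A \<circ> S \<in> SS w p"
  proof (rule ccontr)
    have AS: "A \<circ> S \<in> ops" by (rule ops_comp[OF A So])
    assume "A \<circ> S \<notin> SS w p"
    then obtain A' B where AB: "A' \<in> ops" "B \<in> ops" "\<And>x. x \<in> lsp \<Longrightarrow> A' ((A \<circ> S) (B x)) = x"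
      using not_vanishing_factor[OF AS] AS SS_iff by blast
    have "S \<notin> SS w p"
      using factor_identity_not_SS[OF ops_comp[OF AB(1) A] AB(2) So] AB(3) by simp
    then show False using S by simp
  qed
  have "vanishing (S \<circ> A)"
    unfolding vanishing_def
  proof (intro ballI allI impI)
    fix U and \<delta> :: real assume U: "U \<in> ops" and \<delta>: "0 < \<delta>"
    have "A \<circ> U \<in> ops" by (rule ops_comp[OF A U])
    then show "\<exists>m. \<forall>n\<ge>m. \<forall>k. \<bar>(S \<circ> A) (U (unit_seq n)) k\<bar> < \<delta>"
      using S \<delta> unfolding SS_iff vanishing_def by (metis comp_apply)
  qed
  then show "S \<circ> A \<in> SS w p" by (simp add: SS_iff ops_comp[OF So A])
qed

lemma SS_proper: "SS w p \<noteq> ops"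
proof -
  have "id_op \<notin> SS w p"
    by (rule factor_identity_not_SS[OF id_op_ops id_op_ops id_op_ops]) (simp add: id_op_def)
  then show ?thesis using id_op_ops by blast
qed

text \<open>An operator outside \<open>SS w p\<close> factors the identity, so an ideal containing
  it contains everything.\<close>

lemma proper_ideal_subset_SS:
  assumes J: "is_ideal w p J" and proper: "J \<noteq> ops"
  shows "J \<subseteq> SS w p"
proof (rule ccontr)
  assume "\<not> J \<subseteq> SS w p"
  then obtain T where TJ: "T \<in> J" and nss: "T \<notin> SS w p" by blast
  have T: "T \<in> ops" using J TJ by (auto simp: is_ideal_def)
  obtain A B where AB: "A \<in> ops" "B \<in> ops" and id: "\<And>x. x \<in> lsp \<Longrightarrow> A (T (B x)) = x"
    using not_vanishing_factor[OF T] nss T SS_iff by blast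
  have "S \<in> J" if S: "S \<in> ops" for S
  proof -
    have "S \<circ> (A \<circ> T \<circ> B) \<in> J" using J TJ AB S unfolding is_ideal_def by blast
    \<comment> \<open>Equality of functions includes arguments outside the space, where the
      normalisation makes both sides 0.\<close>
    moreover have "S \<circ> (A \<circ> T \<circ> B) = S"
    proof
      fix x
      show "(S \<circ> (A \<circ> T \<circ> B)) x = S x"
        by (cases "x \<in> lsp")
          (simp_all add: id ops_outside[OF S] ops_outside[OF AB(2)] ops_zero[OF S] ops_zero[OF T] ops_zero[OF AB(1)])
    qed
    ultimately show ?thesis by simp
  qed
  then have "J = ops" using J by (auto simp: is_ideal_def)
  then show False using proper by simp
qed

lemma SS_norm_closed:
  assumes Ts: "\<And>n. Ts n \<in> SS w p" and T: "T \<in> ops"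
    and lim: "(\<lambda>n. opnorm w p (opsub (Ts n) T)) \<longlonglongrightarrow> 0"
  shows "T \<in> SS w p"
proof -
  have "vanishing T"
    unfolding vanishing_def
  proof (intro ballI allI impI)
    fix U and \<delta> :: real assume U: "U \<in> ops" and \<delta>: "0 < \<delta>"
    obtain C where C: "1 \<le> C" "\<And>x. x \<in> lsp \<Longrightarrow> nrm (U x) \<le> C * nrm x" using ops_bound[OF U] by blast
    have "0 < \<delta> / (2 * C)" using \<delta> C by simp
    then have "\<forall>\<^sub>F j in sequentially. opnorm w p (opsub (Ts j) T) < \<delta> / (2 * C)"
      using lim by (intro order_tendstoD) auto
    then obtain j where j: "opnorm w p (opsub (Ts j) T) < \<delta> / (2 * C)"
      by (auto simp: eventually_sequentially)
    define D where "D = opsub (Ts j) T"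
    have D: "D \<in> ops" unfolding D_def using Ts T by (intro ops_opsub) (simp_all add: SS_iff)
    have Dle: "\<bar>D (U (unit_seq n)) k\<bar> < \<delta> / 2" for n k
    proof -
      have Ul: "U (unit_seq n) \<in> lsp" by (rule ops_lsp[OF U unit_seq_lsp])
      \<comment> \<open>Division by \<open>C\<close> brings the image of the unit vector into the
        unit ball, so the operator norm controls \<open>D\<close> uniformly in
        \<open>n\<close>.\<close>
      have y: "vsmul (1 / C) (U (unit_seq n)) \<in> lsp" by (rule lsp_smul(1)[OF Ul])
      have "nrm (vsmul (1 / C) (U (unit_seq n))) \<le> \<bar>1 / C\<bar> * nrm (U (unit_seq n))"
        by (rule lsp_smul(2)[OF Ul])
      also have "\<dots> \<le> \<bar>1 / C\<bar> * C"
        using C(2)[OF unit_seq_lsp, of n] by (intro mult_left_mono) (simp_all add: nrm_unit_seq)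
      also have "\<dots> = 1" using C by simp
      finally have "\<bar>D (vsmul (1 / C) (U (unit_seq n))) k\<bar> \<le> opnorm w p D"
        by (rule abs_le_opnorm[OF D y])
      also have "\<dots> < \<delta> / (2 * C)" using j by (simp add: D_def)
      finally show ?thesis
        using C by (simp add: ops_smul[OF D Ul]) (simp add: vsmul_def abs_mult field_simps)
    qed
    obtain m where m: "\<And>n k. n \<ge> m \<Longrightarrow> \<bar>Ts j (U (unit_seq n)) k\<bar> < \<delta> / 2"
      using Ts[of j] U half_gt_zero[OF \<delta>] unfolding SS_iff vanishing_def by blast
    have "\<bar>T (U (unit_seq n)) k\<bar> < \<delta>" if "n \<ge> m" for n k
    proof -
      have "D (U (unit_seq n)) k = Ts j (U (unit_seq n)) k - T (U (unit_seq n)) k"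
        by (simp add: D_def opsub_def vsub_def)
      then show ?thesis using Dle[of n k] m[OF that, of k] by linarith
    qed
    then show "\<exists>m. \<forall>n\<ge>m. \<forall>k. \<bar>T (U (unit_seq n)) k\<bar> < \<delta>" by blast
  qed
  then show ?thesis using T by (simp add: SS_iff)
qed

end

theorem theorem5p3:
  fixes w :: "nat \<Rightarrow> real" and p :: real
  assumes p: "1 \<le> p"
    and w0: "w 0 = 1"
    and wdec: "antimono w"
    and wlim: "w \<longlonglongrightarrow> 0"
    and wdiv: "\<not> summable w"
  shows "is_ideal w p (SS w p) \<and> SS w p \<noteq> Lop w p
         \<and> (\<forall>J. is_ideal w p J \<and> J \<noteq> Lop w p \<longrightarrow> J \<subseteq> SS w p)
         \<and> (\<forall>Ts T. (\<forall>n. Ts n \<in> SS w p) \<longrightarrow> T \<in> Lop w p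
               \<longrightarrow> (\<lambda>n. opnorm w p (opsub (Ts n) T)) \<longlonglongrightarrow> 0 \<longrightarrow> T \<in> SS w p)"
proof -
  interpret lorentz w p using p w0 wdec wlim by unfold_locales
  show ?thesis using is_ideal_SS SS_proper proper_ideal_subset_SS SS_norm_closed by blast
qed

end
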